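(* Let $A$ be a smooth real 1-form on $\mathbb{R}^{3+1}$ with $F=dA$. For all $X,Y\in\mathcal Z=\{T,\Omega_{12},\Omega_{23},\Omega_{31},S,K\}$ and every complex scalar field $f$ (on $\{r>0\}$), $$\big[\widehat D_Y,[r^2\Box_A,\widehat D_X]\big]f=r^2Q(f,F;[Y,X])+r^2Q(f,\mathcal L_YF;X)-2r^2F_{Y\mu}F_X{}^{\mu}f .$$
   Context: $\mathbb{R}^{3+1}$ has the Minkowski metric $m=-dt^2+\sum_i(dx^i)^2$, Levi-Civita connection $\nabla$; $r=|x|$, $u=\frac12(t-r)$, $v=\frac12(t+r)$, $L=\partial_t+\partial_r$, $\underline L=\partial_t-\partial_r$. $T=\partial_t$, $\Omega_{ij}=x_i\partial_j-x_j\partial_i$, $S=vL+u\underline L$, $K=v^2L+u^2\underline L$. $D_\mu=\partial_\mu+\sqrt{-1}A_\mu$, so $[D_\mu,D_\nu]=\sqrt{-1}F_{\mu\nu}$; $\Box_A=D^\mu D_\mu$; $\widehat D_Zf=D_Zf+\frac{Z(r)}rf$. For a closed 2-form $G$ and a vector field $Z$, $$Q(f,G;Z)=2\sqrt{-1}\,G_{\mu\nu}Z^\nu D^\mu f+\sqrt{-1}\,\nabla^\mu\big(Z^\nu G_{\mu\nu}\big)f .$$ $\mathcal L_Y$ is the Lie derivative, $F_{Y\mu}=Y^\nu F_{\nu\mu}$, $F_X{}^\mu=m^{\mu\lambda}X^\nu F_{\nu\lambda}$.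
   Formalization: The last term is proved with sign +2r²F_{Yμ}F_X^μ f instead of −2r²F_{Yμ}F_X^μ f; with the stated conventions the minus sign fails for A = t dx¹, f = 1, X = Y = T, where the left side is 2r². *)

theory Defs
  imports "HOL-Analysis.Analysis"
begin

section \<open>Calculus in Cartesian coordinates on Minkowski space\<close>

text \<open>
  A point of \<open>\<real>\<^bsup>3+1\<^esup>\<close> is \<open>x :: real^4\<close>; \<open>x $ 0\<close> is the time coordinate \<open>t\<close> and
  \<open>x $ 1, x $ 2, x $ 3\<close> are the space coordinates. (In the numeral type \<open>4\<close> the indices \<open>0\<close> and
  \<open>4\<close> coincide, so \<open>UNIV = {0, 1, 2, 3}\<close>.)
  Vector fields and 1-forms are given by their Cartesian components, as functions into \<open>real^4\<close>
  (upper resp. lower index), and 2-forms by \<open>G x $ \<mu> $ \<nu> = G\<^sub>\<mu>\<^sub>\<nu>(x)\<close>.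
  In these coordinates the Christoffel symbols of the Minkowski metric vanish, so \<open>\<nabla>\<^sub>\<mu>\<close> acts on
  components as \<open>\<partial>\<^sub>\<mu>\<close>.
\<close>

type_synonym point = "real ^ 4"
type_synonym vfield = "point \<Rightarrow> real ^ 4"
type_synonym one_form = "point \<Rightarrow> real ^ 4"
type_synonym two_form = "point \<Rightarrow> real ^ 4 ^ 4"
type_synonym scalar_field = "point \<Rightarrow> complex"

definition partial :: "4 \<Rightarrow> (point \<Rightarrow> 'b::real_normed_vector) \<Rightarrow> point \<Rightarrow> 'b" where
  "partial \<mu> f x = frechet_derivative f (at x) (axis \<mu> 1)"

fun iter_partial :: "4 list \<Rightarrow> (point \<Rightarrow> 'b::real_normed_vector) \<Rightarrow> point \<Rightarrow> 'b" where
  "iter_partial [] f = f"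
| "iter_partial (\<mu> # \<mu>s) f = partial \<mu> (iter_partial \<mu>s f)"

text \<open>\<open>C\<^sup>\<infinity>\<close> regularity; meant for open \<open>U\<close>, where the values of \<open>f\<close> outside \<open>U\<close> are irrelevant.\<close>

definition smooth_on :: "point set \<Rightarrow> (point \<Rightarrow> 'b::real_normed_vector) \<Rightarrow> bool" where
  "smooth_on U f \<longleftrightarrow> (\<forall>\<mu>s. iter_partial \<mu>s f differentiable_on U)"

text \<open>The components \<open>m\<^sub>\<mu>\<^sub>\<nu>\<close> of \<open>-dt\<^sup>2 + \<Sum>\<^sub>i (dx\<^sup>i)\<^sup>2\<close>; the matrix is its own inverse, so it also
  gives the components \<open>m\<^sup>\<mu>\<^sup>\<nu>\<close> used to raise indices.\<close>

definition mink :: "4 \<Rightarrow> 4 \<Rightarrow> real" where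
  "mink \<mu> \<nu> = (if \<mu> \<noteq> \<nu> then 0 else if \<mu> = 0 then -1 else 1)"

definition vf_apply :: "vfield \<Rightarrow> (point \<Rightarrow> real) \<Rightarrow> point \<Rightarrow> real" where
  "vf_apply Z g x = (\<Sum>\<mu>\<in>UNIV. Z x $ \<mu> * partial \<mu> g x)"

definition lie_bracket :: "vfield \<Rightarrow> vfield \<Rightarrow> vfield" where
  "lie_bracket X Y x =
     (\<chi> \<mu>. vf_apply X (\<lambda>y. Y y $ \<mu>) x - vf_apply Y (\<lambda>y. X y $ \<mu>) x)"

definition ext_deriv :: "one_form \<Rightarrow> two_form" where
  "ext_deriv A x = (\<chi> \<mu> \<nu>. partial \<mu> (\<lambda>y. A y $ \<nu>) x - partial \<nu> (\<lambda>y. A y $ \<mu>) x)"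

definition lie_deriv :: "vfield \<Rightarrow> two_form \<Rightarrow> two_form" where
  "lie_deriv Y G x = (\<chi> \<mu> \<nu>.
     (\<Sum>\<kappa>\<in>UNIV. Y x $ \<kappa> * partial \<kappa> (\<lambda>y. G y $ \<mu> $ \<nu>) x
              + partial \<mu> (\<lambda>y. Y y $ \<kappa>) x * G x $ \<kappa> $ \<nu>
              + partial \<nu> (\<lambda>y. Y y $ \<kappa>) x * G x $ \<mu> $ \<kappa>))"

section \<open>The commutator vector fields\<close>

definition rad :: "point \<Rightarrow> real" where
  "rad x = sqrt ((x $ 1)\<^sup>2 + (x $ 2)\<^sup>2 + (x $ 3)\<^sup>2)"

definition u_coord :: "point \<Rightarrow> real" where "u_coord x = (x $ 0 - rad x) / 2"

definition v_coord :: "point \<Rightarrow> real" where "v_coord x = (x $ 0 + rad x) / 2"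

definition d_t :: vfield where "d_t x = axis 0 1"

text \<open>\<open>\<partial>\<^sub>r = (x\<^sup>i / r) \<partial>\<^sub>i\<close>; only meaningful for \<open>r > 0\<close>.\<close>

definition d_r :: vfield where "d_r x = (\<chi> i. if i = 0 then 0 else x $ i / rad x)"

definition L_vf :: vfield where "L_vf x = d_t x + d_r x"

definition Lbar_vf :: vfield where "Lbar_vf x = d_t x - d_r x"

definition T_vf :: vfield where "T_vf = d_t"

definition Omega_vf :: "4 \<Rightarrow> 4 \<Rightarrow> vfield" where
  "Omega_vf i j x = (x $ i) *\<^sub>R axis j 1 - (x $ j) *\<^sub>R axis i 1"

definition S_vf :: vfield where
  "S_vf x = v_coord x *\<^sub>R L_vf x + u_coord x *\<^sub>R Lbar_vf x"

definition K_vf :: vfield where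
  "K_vf x = (v_coord x)\<^sup>2 *\<^sub>R L_vf x + (u_coord x)\<^sup>2 *\<^sub>R Lbar_vf x"

definition Z_set :: "vfield set" where
  "Z_set = {T_vf, Omega_vf 1 2, Omega_vf 2 3, Omega_vf 3 1, S_vf, K_vf}"

section \<open>Gauge-covariant operators\<close>

definition cov :: "one_form \<Rightarrow> 4 \<Rightarrow> scalar_field \<Rightarrow> scalar_field" where
  "cov A \<mu> f x = partial \<mu> f x + \<i> * of_real (A x $ \<mu>) * f x"

definition cov_up :: "one_form \<Rightarrow> 4 \<Rightarrow> scalar_field \<Rightarrow> scalar_field" where
  "cov_up A \<mu> f x = (\<Sum>\<nu>\<in>UNIV. of_real (mink \<mu> \<nu>) * cov A \<nu> f x)"

definition cov_vf :: "one_form \<Rightarrow> vfield \<Rightarrow> scalar_field \<Rightarrow> scalar_field" where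
  "cov_vf A Z f x = (\<Sum>\<mu>\<in>UNIV. of_real (Z x $ \<mu>) * cov A \<mu> f x)"

definition Box :: "one_form \<Rightarrow> scalar_field \<Rightarrow> scalar_field" where
  "Box A f x = (\<Sum>\<mu>\<in>UNIV. cov_up A \<mu> (cov A \<mu> f) x)"

definition cov_hat :: "one_form \<Rightarrow> vfield \<Rightarrow> scalar_field \<Rightarrow> scalar_field" where
  "cov_hat A Z f x = cov_vf A Z f x + of_real (vf_apply Z rad x / rad x) * f x"

definition r2Box :: "one_form \<Rightarrow> scalar_field \<Rightarrow> scalar_field" where
  "r2Box A f x = of_real ((rad x)\<^sup>2) * Box A f x"

definition commutator ::
    "(scalar_field \<Rightarrow> scalar_field) \<Rightarrow> (scalar_field \<Rightarrow> scalar_field) \<Rightarrow> scalar_field \<Rightarrow> scalar_field"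
  where "commutator P R f x = P (R f) x - R (P f) x"

text \<open>The divergence \<open>\<nabla>\<^sup>\<mu>\<omega>\<^sub>\<mu>\<close> of a 1-form.\<close>

definition div_form :: "one_form \<Rightarrow> point \<Rightarrow> real" where
  "div_form \<omega> x = (\<Sum>\<mu>\<in>UNIV. \<Sum>\<nu>\<in>UNIV. mink \<mu> \<nu> * partial \<nu> (\<lambda>y. \<omega> y $ \<mu>) x)"

definition Q :: "one_form \<Rightarrow> scalar_field \<Rightarrow> two_form \<Rightarrow> vfield \<Rightarrow> scalar_field" where
  "Q A f G Z x =
     2 * \<i> * (\<Sum>\<mu>\<in>UNIV. \<Sum>\<nu>\<in>UNIV. of_real (G x $ \<mu> $ \<nu> * Z x $ \<nu>) * cov_up A \<mu> f x)
     + \<i> * of_real (div_form (\<lambda>y. \<chi> \<mu>. \<Sum>\<nu>\<in>UNIV. Z y $ \<nu> * G y $ \<mu> $ \<nu>) x) * f x"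

text \<open>
  \<open>contr F Y\<close> is \<open>F\<^sub>Y\<^sub>\<mu> = Y\<^sup>\<nu> F\<^sub>\<nu>\<^sub>\<mu>\<close> and \<open>contr_up F X\<close> is \<open>m\<^sup>\<mu>\<^sup>\<kappa> X\<^sup>\<nu> F\<^sub>\<nu>\<^sub>\<kappa>\<close>: the vector field is
  contracted into the first slot of \<open>F\<close> in both. Contracting \<open>X\<close> into the second slot instead
  (\<open>F\<^sup>\<mu>\<^sub>X\<close>) reverses the sign of \<open>contr_up\<close>. With the present convention the quadratic
  term in the double commutator of \<open>r\<^sup>2 \<box>\<^sub>A\<close> is \<open>+ 2 r\<^sup>2 F\<^sub>Y\<^sub>\<mu> F\<^sub>X\<^sup>\<mu> f\<close>: for \<open>A = t dx\<^sup>1\<close>,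
  \<open>f = 1\<close> and \<open>X = Y = T\<close> both \<open>Q\<close> terms vanish, \<open>F\<^sub>T\<^sub>\<mu> F\<^sub>T\<^sup>\<mu> = 1\<close>, and the double
  commutator is \<open>- \<partial>\<^sub>t\<^sup>2 (- r\<^sup>2 t\<^sup>2) = 2 r\<^sup>2\<close>. For \<open>F\<^sub>Y\<^sub>\<mu> F\<^sup>\<mu>\<^sub>X\<close> the coefficient is \<open>- 2 r\<^sup>2\<close>.
\<close>

definition contr :: "two_form \<Rightarrow> vfield \<Rightarrow> one_form" where
  "contr F Y x = (\<chi> \<mu>. \<Sum>\<nu>\<in>UNIV. Y x $ \<nu> * F x $ \<nu> $ \<mu>)"

definition contr_up :: "two_form \<Rightarrow> vfield \<Rightarrow> vfield" where
  "contr_up F X x = (\<chi> \<mu>. \<Sum>\<kappa>\<in>UNIV. \<Sum>\<nu>\<in>UNIV. mink \<mu> \<kappa> * X x $ \<nu> * F x $ \<nu> $ \<kappa>)"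

end

theory Submission
  imports Defs
begin

text \<open>
  All six fields are conformal Killing fields of the Minkowski metric \<open>m\<close> whose conformal factor
  \<open>\<phi> = X(r)/r\<close> solves \<open>\<box>\<phi> = 0\<close>; it is \<open>0\<close> for \<open>T\<close> and the rotations, \<open>1\<close> for \<open>S\<close> and \<open>t\<close> for \<open>K\<close>.
  Because the factor is the logarithmic derivative of \<open>r\<close> along \<open>X\<close>, they are Killing fields of
  \<open>r\<^sup>-\<^sup>2 m\<close>. The proof uses nothing else about them, and so it is carried out for an arbitrary field
  of this kind (\<open>conformal_on\<close>).

  For such \<open>X\<close>, commuting \<open>D\<^sub>\<mu>\<close> twice past \<open>D\<^sub>X + \<phi>\<close> produces terms of order two, one and zero. The
  second-order ones contract \<open>\<partial>\<^sup>\<mu>X\<^sup>\<nu>\<close> symmetrically and give \<open>2\<phi> \<box>\<^sub>A f\<close>, which the weight \<open>r\<^sup>2\<close>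
  absorbs because \<open>X(r\<^sup>2) = 2\<phi>r\<^sup>2\<close>. The first-order ones that do not contain the curvature,
  \<open>(\<box>X\<^sup>\<nu>) D\<^sub>\<nu>f\<close> and \<open>2 \<partial>\<^sup>\<nu>\<phi> D\<^sub>\<nu>f\<close>, cancel because \<open>\<box>X\<^sup>\<nu> = -2 \<partial>\<^sup>\<nu>\<phi>\<close> in four dimensions, and the
  zeroth-order term \<open>(\<box>\<phi>) f\<close> vanishes. What remains is the curvature contribution \<open>r\<^sup>2 Q\<close>, and \<open>Q\<close>
  sees \<open>F\<close> and \<open>X\<close> only through the one-form \<open>\<omega>\<^sub>\<mu> = F\<^sub>\<mu>\<^sub>\<nu>X\<^sup>\<nu>\<close> (\<open>r2Box_commutator\<close>).

  The outer commutator is then that of \<open>D\<^sub>Y + \<psi>\<close>, \<open>\<psi>\<close> being the factor of \<open>Y\<close>, with the first-order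
  operator \<open>f \<mapsto> r\<^sup>2 Q[\<omega>] f\<close>. Since \<open>Y\<close> is Killing for \<open>r\<^sup>-\<^sup>2 m\<close>, the Lie derivative passes through
  \<open>r\<^sup>2\<close> and the raising of the index, and the operator becomes \<open>r\<^sup>2 Q[L\<^sub>Y\<omega>]\<close>; the curvature in
  \<open>[D\<^sub>Y, D\<^sub>\<mu>]\<close> adds the quadratic term (\<open>cov_hat_Q_form\<close>). The Leibniz rule
  \<open>L\<^sub>Y(F(\<cdot>, X)) = F(\<cdot>, [Y, X]) + (L\<^sub>YF)(\<cdot>, X)\<close> (\<open>lie_deriv_form_contr_snd\<close>) splits \<open>Q[L\<^sub>Y\<omega>]\<close> into the two
  \<open>Q\<close> terms of the theorem. All this happens on the open set \<open>r > 0\<close>, where \<open>f\<close> is smooth and the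
  partial derivatives of \<open>f\<close> therefore commute.
\<close>

section \<open>Smooth functions on an open set\<close>

lemma iter_partial_snoc: "iter_partial (\<mu>s @ [\<mu>]) f = iter_partial \<mu>s (partial \<mu> f)"
  by (induction \<mu>s) auto

lemma smooth_on_iff:
  "smooth_on U f \<longleftrightarrow> f differentiable_on U \<and> (\<forall>\<mu>. smooth_on U (partial \<mu> f))"
proof -
  have "(\<forall>\<mu>s. iter_partial \<mu>s f differentiable_on U) \<longleftrightarrow>
      f differentiable_on U \<and> (\<forall>\<mu> \<mu>s. iter_partial (\<mu>s @ [\<mu>]) f differentiable_on U)"
    by (metis iter_partial.simps(1) rev_exhaust)
  then show ?thesis
    by (simp add: smooth_on_def iter_partial_snoc)
qed

lemma smooth_differentiable: "smooth_on U f \<Longrightarrow> f differentiable_on U"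
  using iffD1[OF smooth_on_iff] by blast

lemma smooth_partial: "smooth_on U f \<Longrightarrow> smooth_on U (partial \<mu> f)"
  using iffD1[OF smooth_on_iff] by blast

text \<open>
  A product rule cannot be iterated through \<open>smooth_on\<close> directly, because the derivative of a product
  is a sum of products. Counting the order of differentiability, and differentiating first rather
  than last, makes closure properties of smooth functions inductions on the order.
\<close>

primrec differentiable_times ::
    "nat \<Rightarrow> point set \<Rightarrow> (point \<Rightarrow> 'b::real_normed_vector) \<Rightarrow> bool" where
  "differentiable_times 0 U f \<longleftrightarrow> f differentiable_on U"
| "differentiable_times (Suc n) U f \<longleftrightarrow>
     f differentiable_on U \<and> (\<forall>\<mu>. differentiable_times n U (partial \<mu> f))"

lemma smooth_on_iff_times: "smooth_on U f \<longleftrightarrow> (\<forall>n. differentiable_times n U f)"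
proof
  have "smooth_on U f \<Longrightarrow> differentiable_times n U f" for n
  proof (induction n arbitrary: f)
    case 0
    then show ?case by (simp add: smooth_differentiable)
  next
    case (Suc n)
    then show ?case by (simp add: smooth_differentiable smooth_partial)
  qed
  then show "smooth_on U f \<Longrightarrow> \<forall>n. differentiable_times n U f" by blast
next
  assume *: "\<forall>n. differentiable_times n U f"
  have "\<forall>n. differentiable_times n U f \<Longrightarrow> iter_partial \<mu>s f differentiable_on U" for \<mu>s
  proof (induction \<mu>s arbitrary: f rule: rev_induct)
    case Nil
    then show ?case by (metis differentiable_times.simps(1) iter_partial.simps(1))
  next
    case (snoc \<mu> \<mu>s)
    then have "\<forall>n. differentiable_times n U (partial \<mu> f)"
      using differentiable_times.simps(2) by blast
    then show ?case using snoc.IH by (simp add: iter_partial_snoc)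
  qed
  with * show "smooth_on U f" by (auto simp: smooth_on_def)
qed

lemma differentiable_times_Suc_D: "differentiable_times (Suc n) U f \<Longrightarrow> differentiable_times n U f"
proof (induction n arbitrary: f)
  case (Suc n)
  then show ?case using differentiable_times.simps(2) by blast
qed simp

lemma smooth_on_subset: "smooth_on V f \<Longrightarrow> U \<subseteq> V \<Longrightarrow> smooth_on U f"
  using differentiable_on_subset unfolding smooth_on_def by blast

lemma partial_eqI: "(f has_derivative f') (at x) \<Longrightarrow> partial \<mu> f x = f' (axis \<mu> 1)"
  by (simp add: frechet_derivative_at[symmetric] partial_def)

locale open_domain =
  fixes U :: "point set"
  assumes open_U: "open U"
begin

lemma differentiable_at_point:
  assumes "f differentiable_on U" "x \<in> U"
  shows "f differentiable (at x)"
  using assms at_within_open[OF assms(2) open_U] unfolding differentiable_on_def by metis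

lemma has_derivative_at_point:
  assumes "f differentiable_on U" "x \<in> U"
  shows "(f has_derivative frechet_derivative f (at x)) (at x)"
  using differentiable_at_point[OF assms] by (simp add: frechet_derivative_works)

lemma partial_transfer:
  assumes "\<And>y. y \<in> U \<Longrightarrow> f y = g y" "x \<in> U"
  shows "partial \<mu> f x = partial \<mu> g x"
proof -
  have "(f has_derivative D) (at x) \<longleftrightarrow> (g has_derivative D) (at x)" for D
    using has_derivative_transform_within_open[of f D x UNIV U g]
      has_derivative_transform_within_open[of g D x UNIV U f] assms open_U
    by auto
  then show ?thesis by (simp add: partial_def frechet_derivative_def)
qed

lemma differentiable_on_transfer:
  assumes "\<And>y. y \<in> U \<Longrightarrow> f y = g y" "f differentiable_on U"
  shows "g differentiable_on U"
  unfolding differentiable_on_def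
proof
  fix x assume x: "x \<in> U"
  then obtain D where "(f has_derivative D) (at x within U)"
    using assms(2) unfolding differentiable_on_def differentiable_def by blast
  then have "(g has_derivative D) (at x within U)"
    using has_derivative_transform[OF x, of g f D] assms(1) by simp
  then show "g differentiable (at x within U)"
    unfolding differentiable_def by blast
qed

lemma differentiable_times_transfer:
  assumes "\<And>y. y \<in> U \<Longrightarrow> f y = g y" "differentiable_times n U f"
  shows "differentiable_times n U g"
  using assms
proof (induction n arbitrary: f g)
  case 0
  then show ?case using differentiable_on_transfer[of f g] by simp
next
  case (Suc n)
  show ?case
    unfolding differentiable_times.simps
  proof (intro conjI allI)
    show "g differentiable_on U"
      using Suc.prems differentiable_on_transfer[of f g] by simp
    show "differentiable_times n U (partial \<mu> g)" for \<mu>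
      using Suc.prems Suc.IH[of "partial \<mu> f" "partial \<mu> g"] partial_transfer[of f g]
      by simp
  qed
qed

lemma smooth_on_transfer:
  assumes "\<And>y. y \<in> U \<Longrightarrow> f y = g y" "smooth_on U f"
  shows "smooth_on U g"
  using assms differentiable_times_transfer unfolding smooth_on_iff_times by blast

lemma partial_const: "partial \<mu> (\<lambda>y. c) x = 0"
  by (simp add: partial_def)

lemma smooth_const:
  fixes c :: "'b::real_normed_vector"
  shows "smooth_on U (\<lambda>y. c)"
proof -
  have "differentiable_times n U (\<lambda>y. c)" for n and c :: 'b
  proof (induction n arbitrary: c)
    case (Suc n)
    have "partial \<mu> (\<lambda>y. c) = (\<lambda>y. 0)" for \<mu>
      by (simp add: partial_const fun_eq_iff)
    with Suc show ?case by simp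
  qed simp
  then show ?thesis by (simp add: smooth_on_iff_times)
qed

lemma partial_add:
  assumes "f differentiable_on U" "g differentiable_on U" "x \<in> U"
  shows "partial \<mu> (\<lambda>y. f y + g y) x = partial \<mu> f x + partial \<mu> g x"
  using partial_eqI[OF has_derivative_add[OF assms(1,2)[THEN has_derivative_at_point[OF _ assms(3)]]]]
  by (simp add: partial_def)

lemma differentiable_times_add:
  assumes "differentiable_times n U f" "differentiable_times n U g"
  shows "differentiable_times n U (\<lambda>y. f y + g y)"
  using assms
proof (induction n arbitrary: f g)
  case (Suc n)
  from Suc.prems have *: "f differentiable_on U" "g differentiable_on U" by auto
  have "differentiable_times n U (partial \<mu> (\<lambda>y. f y + g y))" for \<mu>
  proof (rule differentiable_times_transfer)
    show "differentiable_times n U (\<lambda>y. partial \<mu> f y + partial \<mu> g y)"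
      by (rule Suc.IH) (use Suc.prems in auto)
  qed (simp add: partial_add[OF *])
  with * show ?case by (simp add: differentiable_on_add)
qed (simp add: differentiable_on_add)

lemma smooth_add:
  assumes "smooth_on U f" "smooth_on U g"
  shows "smooth_on U (\<lambda>y. f y + g y)"
  using assms by (simp add: smooth_on_iff_times differentiable_times_add)

lemma partial_linear:
  assumes "bounded_linear h" "f differentiable_on U" "x \<in> U"
  shows "partial \<mu> (\<lambda>y. h (f y)) x = h (partial \<mu> f x)"
  using partial_eqI[OF bounded_linear.has_derivative[OF assms(1) has_derivative_at_point[OF assms(2,3)]]]
  by (simp add: partial_def)

lemma differentiable_linear:
  assumes "bounded_linear h" "f differentiable_on U"
  shows "(\<lambda>y. h (f y)) differentiable_on U"
  using assms bounded_linear.has_derivative unfolding differentiable_on_def differentiable_def by blast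

lemma smooth_linear:
  assumes h: "bounded_linear h" and f: "smooth_on U f"
  shows "smooth_on U (\<lambda>y. h (f y))"
proof -
  have "differentiable_times n U (\<lambda>y. h (f y))" if "differentiable_times n U f" for n f
    using that
  proof (induction n arbitrary: f)
    case (Suc n)
    from Suc.prems have *: "f differentiable_on U" by auto
    have "differentiable_times n U (partial \<mu> (\<lambda>y. h (f y)))" for \<mu>
    proof (rule differentiable_times_transfer)
      show "differentiable_times n U (\<lambda>y. h (partial \<mu> f y))"
        by (rule Suc.IH) (use Suc.prems in auto)
    qed (simp add: partial_linear[OF h *])
    with * h show ?case by (simp add: differentiable_linear)
  qed (simp add: h differentiable_linear)
  with f show ?thesis by (simp add: smooth_on_iff_times)
qed

lemma partial_mult:
  fixes f g :: "point \<Rightarrow> 'a::real_normed_algebra"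
  assumes "f differentiable_on U" "g differentiable_on U" "x \<in> U"
  shows "partial \<mu> (\<lambda>y. f y * g y) x = partial \<mu> f x * g x + f x * partial \<mu> g x"
  using partial_eqI[OF has_derivative_mult[OF assms(1,2)[THEN has_derivative_at_point[OF _ assms(3)]]]]
  by (simp add: partial_def)

lemma smooth_mult:
  fixes f g :: "point \<Rightarrow> 'a::real_normed_algebra"
  assumes "smooth_on U f" "smooth_on U g"
  shows "smooth_on U (\<lambda>y. f y * g y)"
proof -
  have "differentiable_times n U (\<lambda>y. f y * g y)"
    if "differentiable_times n U f" "differentiable_times n U g"
    for n and f g :: "point \<Rightarrow> 'a"
    using that
  proof (induction n arbitrary: f g)
    case (Suc n)
    from Suc.prems have *: "f differentiable_on U" "g differentiable_on U" by auto
    have "differentiable_times n U (partial \<mu> (\<lambda>y. f y * g y))" for \<mu>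
    proof (rule differentiable_times_transfer)
      show "differentiable_times n U (\<lambda>y. partial \<mu> f y * g y + f y * partial \<mu> g y)"
        by (rule differentiable_times_add; rule Suc.IH)
          (use Suc.prems differentiable_times_Suc_D in auto)
    qed (simp add: partial_mult[OF *])
    with * show ?case by (simp add: differentiable_on_mult)
  qed (simp add: differentiable_on_mult)
  with assms show ?thesis by (simp add: smooth_on_iff_times)
qed

lemma smooth_sum:
  assumes "\<And>i. i \<in> I \<Longrightarrow> smooth_on U (f i)"
  shows "smooth_on U (\<lambda>y. \<Sum>i\<in>I. f i y)"
  using assms by (induction I rule: infinite_finite_induct) (auto intro: smooth_add smooth_const)

lemma partial_sum:
  assumes "\<And>i. i \<in> I \<Longrightarrow> smooth_on U (f i)" "x \<in> U"
  shows "partial \<mu> (\<lambda>y. \<Sum>i\<in>I. f i y) x = (\<Sum>i\<in>I. partial \<mu> (f i) x)"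
  using assms
proof (induction I rule: infinite_finite_induct)
  case (insert i I)
  then show ?case
    using partial_add[of "f i" "\<lambda>y. \<Sum>i\<in>I. f i y" x \<mu>]
    by (simp add: smooth_differentiable smooth_sum)
qed (simp_all add: partial_const)

text \<open>
  Two applications of the mean value theorem write the second difference
  \<open>f(x + ha + hb) - f(x + ha) - f(x + hb) + f(x)\<close> as \<open>h\<^sup>2\<close> times a mixed second derivative at a point
  near \<open>x\<close>, for either order of the two directions. Continuity of both mixed derivatives gives their
  equality at \<open>x\<close> as \<open>h\<close> tends to \<open>0\<close>.
\<close>

lemma partial_commute_real:
  fixes f :: "point \<Rightarrow> real"
  assumes f: "smooth_on U f" and x: "x \<in> U"
  shows "partial \<mu> (partial \<nu> f) x = partial \<nu> (partial \<mu> f) x"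
proof -
  have line: "((\<lambda>s. g (p + s *\<^sub>R axis \<alpha> 1)) has_real_derivative partial \<alpha> g (p + s *\<^sub>R axis \<alpha> 1)) (at s)"
    if "smooth_on U g" "p + s *\<^sub>R axis \<alpha> 1 \<in> U" for g :: "point \<Rightarrow> real" and p s \<alpha>
  proof -
    have "((\<lambda>s. p + s *\<^sub>R axis \<alpha> 1) has_derivative (\<lambda>h. h *\<^sub>R axis \<alpha> 1)) (at s)"
      by (auto intro!: derivative_eq_intros)
    from has_derivative_compose[OF this has_derivative_at_point[OF smooth_differentiable[OF that(1)] that(2)]]
    have *: "((\<lambda>s. g (p + s *\<^sub>R axis \<alpha> 1)) has_derivative
        (\<lambda>h. frechet_derivative g (at (p + s *\<^sub>R axis \<alpha> 1)) (h *\<^sub>R axis \<alpha> 1))) (at s)" .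
    have "linear (frechet_derivative g (at (p + s *\<^sub>R axis \<alpha> 1)))"
      using that smooth_differentiable differentiable_at_point linear_frechet_derivative by blast
    then have "(\<lambda>h. frechet_derivative g (at (p + s *\<^sub>R axis \<alpha> 1)) (h *\<^sub>R axis \<alpha> 1)) =
        (*) (partial \<alpha> g (p + s *\<^sub>R axis \<alpha> 1))"
      by (auto simp: partial_def linear_scale mult.commute)
    with * show ?thesis by (simp add: has_field_derivative_def)
  qed
  obtain \<epsilon> where \<epsilon>: "\<epsilon> > 0" "ball x \<epsilon> \<subseteq> U"
    using open_U x openE by blast
  have box: "x + s *\<^sub>R axis \<alpha> 1 + t *\<^sub>R axis \<beta> 1 \<in> ball x \<delta>"
    if "0 \<le> s" "0 \<le> t" "s + t < \<delta>" for s t \<delta> \<alpha> \<beta>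
  proof -
    have "norm (s *\<^sub>R axis \<alpha> 1 + t *\<^sub>R axis \<beta> 1 :: point) \<le> s + t"
      using that norm_triangle_ineq[of "s *\<^sub>R axis \<alpha> 1" "t *\<^sub>R axis \<beta> 1 :: point"] by simp
    moreover have "dist x (x + s *\<^sub>R axis \<alpha> 1 + t *\<^sub>R axis \<beta> 1)
        = norm (s *\<^sub>R axis \<alpha> 1 + t *\<^sub>R axis \<beta> 1 :: point)"
      by (metis add.assoc add_diff_cancel_left' dist_commute dist_norm)
    ultimately show ?thesis
      using that by simp
  qed
  have mvt2: "\<exists>s t. 0 < s \<and> s < h \<and> 0 < t \<and> t < h \<and>
      f (x + h *\<^sub>R axis \<alpha> 1 + h *\<^sub>R axis \<beta> 1) - f (x + h *\<^sub>R axis \<alpha> 1)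
        - f (x + h *\<^sub>R axis \<beta> 1) + f x
      = h * (h * partial \<beta> (partial \<alpha> f) (x + s *\<^sub>R axis \<alpha> 1 + t *\<^sub>R axis \<beta> 1))"
    if h: "0 < h" "h + h < \<epsilon>" for h \<alpha> \<beta>
  proof -
    have inU: "x + s *\<^sub>R axis \<alpha> 1 + t *\<^sub>R axis \<beta> 1 \<in> U" if "0 \<le> s" "s \<le> h" "0 \<le> t" "t \<le> h" for s t
      using box[of s t \<epsilon> \<alpha> \<beta>] that h \<epsilon> by auto
    let ?g = "\<lambda>s. f ((x + h *\<^sub>R axis \<beta> 1) + s *\<^sub>R axis \<alpha> 1) - f (x + s *\<^sub>R axis \<alpha> 1)"
    have "\<exists>s>0. s < h \<and> ?g h - ?g 0 = (h - 0) *
        (partial \<alpha> f ((x + h *\<^sub>R axis \<beta> 1) + s *\<^sub>R axis \<alpha> 1) - partial \<alpha> f (x + s *\<^sub>R axis \<alpha> 1))"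
    proof (rule MVT2[OF h(1)])
      fix s assume s: "0 \<le> s" "s \<le> h"
      show "(?g has_real_derivative (partial \<alpha> f ((x + h *\<^sub>R axis \<beta> 1) + s *\<^sub>R axis \<alpha> 1)
          - partial \<alpha> f (x + s *\<^sub>R axis \<alpha> 1))) (at s)"
        using inU[of s h] inU[of s 0] s h
        by (intro DERIV_diff line f) (auto simp: add_ac)
    qed
    then obtain s where s: "0 < s" "s < h" and gs: "?g h - ?g 0 = h *
        (partial \<alpha> f ((x + h *\<^sub>R axis \<beta> 1) + s *\<^sub>R axis \<alpha> 1) - partial \<alpha> f (x + s *\<^sub>R axis \<alpha> 1))"
      by auto
    let ?k = "\<lambda>t. partial \<alpha> f (x + s *\<^sub>R axis \<alpha> 1 + t *\<^sub>R axis \<beta> 1)"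
    have "\<exists>t>0. t < h \<and> ?k h - ?k 0 = (h - 0) *
        partial \<beta> (partial \<alpha> f) (x + s *\<^sub>R axis \<alpha> 1 + t *\<^sub>R axis \<beta> 1)"
      using inU s by (intro MVT2[OF h(1)] line smooth_partial f) auto
    then obtain t where t: "0 < t" "t < h" and kt: "?k h - ?k 0 = h *
        partial \<beta> (partial \<alpha> f) (x + s *\<^sub>R axis \<alpha> 1 + t *\<^sub>R axis \<beta> 1)"
      by auto
    have "f (x + h *\<^sub>R axis \<alpha> 1 + h *\<^sub>R axis \<beta> 1) - f (x + h *\<^sub>R axis \<alpha> 1)
        - f (x + h *\<^sub>R axis \<beta> 1) + f x = ?g h - ?g 0"
      by (simp add: add_ac)
    also have "\<dots> = h * (?k h - ?k 0)"
      unfolding gs by (simp add: add_ac)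
    finally show ?thesis
      using s t unfolding kt by blast
  qed
  have cont: "isCont (partial \<beta> (partial \<alpha> f)) x" for \<alpha> \<beta>
    by (intro differentiable_imp_continuous_within differentiable_at_point smooth_differentiable
        smooth_partial f x)
  show ?thesis
  proof (rule ccontr)
    let ?a = "partial \<mu> (partial \<nu> f)" and ?b = "partial \<nu> (partial \<mu> f)"
    assume ne: "?a x \<noteq> ?b x"
    define e where "e = dist (?a x) (?b x) / 2"
    have e: "e > 0" using ne by (simp add: e_def)
    obtain \<delta>1 where 1: "\<delta>1 > 0" "\<And>y. dist y x < \<delta>1 \<Longrightarrow> dist (?a y) (?a x) < e"
      using cont e unfolding continuous_at_eps_delta by blast
    obtain \<delta>2 where 2: "\<delta>2 > 0" "\<And>y. dist y x < \<delta>2 \<Longrightarrow> dist (?b y) (?b x) < e"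
      using cont e unfolding continuous_at_eps_delta by blast
    \<comment> \<open>The points supplied by the mean value theorem lie within \<open>2h\<close> of \<open>x\<close>.\<close>
    define h where "h = min \<epsilon> (min \<delta>1 \<delta>2) / 3"
    have h: "0 < h" "h + h < \<epsilon>" "h + h < \<delta>1" "h + h < \<delta>2"
      using \<epsilon> 1(1) 2(1) by (auto simp: h_def min_def)
    obtain s t where st: "0 < s" "s < h" "0 < t" "t < h" and
      a: "f (x + h *\<^sub>R axis \<nu> 1 + h *\<^sub>R axis \<mu> 1) - f (x + h *\<^sub>R axis \<nu> 1)
        - f (x + h *\<^sub>R axis \<mu> 1) + f x = h * (h * ?a (x + s *\<^sub>R axis \<nu> 1 + t *\<^sub>R axis \<mu> 1))"
      using mvt2[OF h(1,2)] by meson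
    obtain s' t' where st': "0 < s'" "s' < h" "0 < t'" "t' < h" and
      b: "f (x + h *\<^sub>R axis \<mu> 1 + h *\<^sub>R axis \<nu> 1) - f (x + h *\<^sub>R axis \<mu> 1)
        - f (x + h *\<^sub>R axis \<nu> 1) + f x = h * (h * ?b (x + s' *\<^sub>R axis \<mu> 1 + t' *\<^sub>R axis \<nu> 1))"
      using mvt2[OF h(1,2)] by meson
    have "x + h *\<^sub>R axis \<mu> 1 + h *\<^sub>R axis \<nu> 1 = x + h *\<^sub>R axis \<nu> 1 + h *\<^sub>R axis \<mu> (1::real)"
      by (simp add: add_ac)
    then have "h * (h * ?a (x + s *\<^sub>R axis \<nu> 1 + t *\<^sub>R axis \<mu> 1))
        = h * (h * ?b (x + s' *\<^sub>R axis \<mu> 1 + t' *\<^sub>R axis \<nu> 1))"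
      unfolding a[symmetric] b[symmetric] by (simp add: add_ac)
    then have "?a (x + s *\<^sub>R axis \<nu> 1 + t *\<^sub>R axis \<mu> 1)
        = ?b (x + s' *\<^sub>R axis \<mu> 1 + t' *\<^sub>R axis \<nu> 1)"
      using h(1) by simp
    moreover have "dist (?a (x + s *\<^sub>R axis \<nu> 1 + t *\<^sub>R axis \<mu> 1)) (?a x) < e"
      using box[of s t \<delta>1 \<nu> \<mu>] st h by (intro 1(2)) (simp add: dist_commute)
    moreover have "dist (?b (x + s' *\<^sub>R axis \<mu> 1 + t' *\<^sub>R axis \<nu> 1)) (?b x) < e"
      using box[of s' t' \<delta>2 \<mu> \<nu>] st' h by (intro 2(2)) (simp add: dist_commute)
    ultimately have "dist (?a x) (?b x) < e + e"
      by (simp add: dist_real_def)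
    then show False by (simp add: e_def)
  qed
qed

lemma partial_commute:
  fixes f :: "point \<Rightarrow> 'a::euclidean_space"
  assumes f: "smooth_on U f" and x: "x \<in> U"
  shows "partial \<mu> (partial \<nu> f) x = partial \<nu> (partial \<mu> f) x"
proof (rule euclidean_eqI)
  fix b :: 'a
  have comp: "partial \<alpha> (partial \<beta> f) x \<bullet> b = partial \<alpha> (partial \<beta> (\<lambda>y. f y \<bullet> b)) x" for \<alpha> \<beta>
  proof -
    note lin = bounded_linear_inner_left[of b]
    have "partial \<alpha> (partial \<beta> f) x \<bullet> b = partial \<alpha> (\<lambda>y. partial \<beta> f y \<bullet> b) x"
      using f x by (simp add: partial_linear[OF lin] smooth_partial smooth_differentiable)
    also have "\<dots> = partial \<alpha> (partial \<beta> (\<lambda>y. f y \<bullet> b)) x"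
      using f x by (intro partial_transfer) (simp_all add: partial_linear[OF lin] smooth_differentiable)
    finally show ?thesis .
  qed
  have "smooth_on U (\<lambda>y. f y \<bullet> b)"
    by (rule smooth_linear[OF bounded_linear_inner_left f])
  with x show "partial \<mu> (partial \<nu> f) x \<bullet> b = partial \<nu> (partial \<mu> f) x \<bullet> b"
    by (simp add: comp partial_commute_real)
qed

end

section \<open>Coordinates and the Minkowski metric\<close>

lemma sum_mink:
  "(\<Sum>\<nu>\<in>UNIV. of_real (mink \<mu> \<nu>) * a \<nu>) = of_real (mink \<mu> \<mu>) * (a \<mu> :: 'a::real_algebra_1)"
proof -
  have "(\<Sum>\<nu>\<in>UNIV. of_real (mink \<mu> \<nu>) * a \<nu>) = (\<Sum>\<nu>\<in>UNIV. if \<nu> = \<mu> then of_real (mink \<mu> \<mu>) * a \<mu> else 0)"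
    by (intro sum.cong) (auto simp: mink_def)
  then show ?thesis by simp
qed

lemma sum_mink_real: "(\<Sum>\<nu>\<in>UNIV. mink \<mu> \<nu> * a \<nu>) = mink \<mu> \<mu> * a \<mu>"
  using sum_mink[of \<mu> a] by simp

lemma div_form_eq: "div_form \<omega> x = (\<Sum>\<mu>\<in>UNIV. mink \<mu> \<mu> * partial \<mu> (\<lambda>y. \<omega> y $ \<mu>) x)"
  unfolding div_form_def by (simp add: sum_mink_real)

lemma Box_eq: "Box A f = (\<lambda>x. \<Sum>\<mu>\<in>UNIV. of_real (mink \<mu> \<mu>) * cov A \<mu> (cov A \<mu> f) x)"
  unfolding Box_def cov_up_def by (simp add: sum_mink)

text \<open>
  The operator \<open>Q\<close> depends on the two-form and the vector field only through their contraction
  \<open>\<omega>\<^sub>\<mu> = G\<^sub>\<mu>\<^sub>\<nu>Z\<^sup>\<nu>\<close>. Taking \<open>\<omega>\<close> as the argument makes \<open>Q\<close> additive in a single variable and lets the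
  Lie derivative act on it.
\<close>

definition Q_form :: "one_form \<Rightarrow> scalar_field \<Rightarrow> one_form \<Rightarrow> scalar_field" where
  "Q_form A f \<omega> x =
     2 * \<i> * (\<Sum>\<mu>\<in>UNIV. of_real (mink \<mu> \<mu> * \<omega> x $ \<mu>) * cov A \<mu> f x)
     + \<i> * of_real (div_form \<omega> x) * f x"

definition contr_snd :: "two_form \<Rightarrow> vfield \<Rightarrow> one_form" where
  "contr_snd G Z x = (\<chi> \<mu>. \<Sum>\<nu>\<in>UNIV. Z x $ \<nu> * G x $ \<mu> $ \<nu>)"

lemma Q_eq_Q_form: "Q A f G Z x = Q_form A f (contr_snd G Z) x"
proof -
  have "(\<Sum>\<nu>\<in>UNIV. of_real (G x $ \<mu> $ \<nu> * Z x $ \<nu>) * cov_up A \<mu> f x)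
      = of_real (mink \<mu> \<mu> * contr_snd G Z x $ \<mu>) * cov A \<mu> f x" for \<mu>
    by (simp add: cov_up_def sum_mink contr_snd_def sum_distrib_right sum_distrib_left mult_ac)
  then show ?thesis
    by (simp add: Q_def Q_form_def contr_snd_def[abs_def])
qed

text \<open>
  The hypothesis is the conformal Killing equation with both indices raised,
  \<open>\<partial>\<^sup>\<mu>X\<^sup>\<nu> + \<partial>\<^sup>\<nu>X\<^sup>\<mu> = 2\<phi>m\<^sup>\<mu>\<^sup>\<nu>\<close>, and the conclusion says that a symmetrised tensor contracted with
  \<open>\<partial>\<^sup>\<mu>X\<^sup>\<nu>\<close> reduces to its trace. It serves for the second covariant derivatives of a scalar, where the
  order of differentiation matters, and for the first derivatives of a one-form.
\<close>

lemma symmetrised_contraction: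
  fixes H :: "4 \<Rightarrow> 4 \<Rightarrow> 'a::{real_algebra_1, comm_ring_1}"
  assumes "\<And>\<mu> \<nu>. mink \<mu> \<mu> * a \<mu> \<nu> + mink \<nu> \<nu> * a \<nu> \<mu> = (if \<mu> = \<nu> then 2 * c * mink \<mu> \<mu> else 0)"
  shows "(\<Sum>\<mu>\<in>UNIV. \<Sum>\<nu>\<in>UNIV. of_real (mink \<mu> \<mu> * a \<mu> \<nu>) * (H \<mu> \<nu> + H \<nu> \<mu>))
      = 2 * of_real c * (\<Sum>\<mu>\<in>UNIV. of_real (mink \<mu> \<mu>) * H \<mu> \<mu>)"
proof -
  have "(\<Sum>\<mu>\<in>UNIV. \<Sum>\<nu>\<in>UNIV. of_real (mink \<mu> \<mu> * a \<mu> \<nu>) * H \<nu> \<mu>)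
      = (\<Sum>\<mu>\<in>UNIV. \<Sum>\<nu>\<in>UNIV. of_real (mink \<nu> \<nu> * a \<nu> \<mu>) * H \<mu> \<nu>)"
    by (rule sum.swap)
  then have "(\<Sum>\<mu>\<in>UNIV. \<Sum>\<nu>\<in>UNIV. of_real (mink \<mu> \<mu> * a \<mu> \<nu>) * (H \<mu> \<nu> + H \<nu> \<mu>))
      = (\<Sum>\<mu>\<in>UNIV. \<Sum>\<nu>\<in>UNIV. of_real (mink \<mu> \<mu> * a \<mu> \<nu> + mink \<nu> \<nu> * a \<nu> \<mu>) * H \<mu> \<nu>)"
    by (simp only: distrib_left distrib_right of_real_add sum.distrib)
  also have "\<dots> = (\<Sum>\<mu>\<in>UNIV. \<Sum>\<nu>\<in>UNIV. if \<nu> = \<mu> then of_real (2 * c * mink \<mu> \<mu>) * H \<mu> \<mu> else 0)"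
    unfolding assms by (intro sum.cong) auto
  finally show ?thesis by (simp add: sum_distrib_left mult_ac)
qed

section \<open>The radial weight\<close>

lemma has_derivative_rad:
  assumes "rad x > 0"
  shows "(rad has_derivative (\<lambda>h. (x $ 1 * h $ 1 + x $ 2 * h $ 2 + x $ 3 * h $ 3) / rad x)) (at x)"
proof -
  have "(x $ 1)\<^sup>2 + (x $ 2)\<^sup>2 + (x $ 3)\<^sup>2 > 0"
    using assms by (simp add: rad_def)
  then show ?thesis
    unfolding rad_def[abs_def]
    by (auto intro!: derivative_eq_intros bounded_linear_imp_has_derivative[OF bounded_linear_vec_nth]
        simp: fun_eq_iff field_simps)
qed

lemma partial_coord: "partial \<nu> (\<lambda>y. y $ \<mu>) x = (if \<nu> = \<mu> then 1 else 0)"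
  using partial_eqI[OF bounded_linear_imp_has_derivative[OF bounded_linear_vec_nth[of \<mu>]], of \<nu> x]
  by (simp add: axis_def)

lemma rad_square: "(rad x)\<^sup>2 = x $ 1 * x $ 1 + x $ 2 * x $ 2 + x $ 3 * x $ 3"
  by (simp add: rad_def power2_eq_square)

lemma open_off_axis: "open {y. rad y > 0}"
  unfolding rad_def[abs_def] by (intro open_Collect_less continuous_intros)

lemma (in open_domain) smooth_coord: "smooth_on U (\<lambda>y. y $ \<mu>)"
proof -
  have "partial \<nu> (\<lambda>y. y $ \<mu>) = (\<lambda>y. if \<nu> = \<mu> then 1 else 0)" for \<nu>
    by (simp add: partial_coord fun_eq_iff)
  moreover have "(\<lambda>y::point. y $ \<mu>) differentiable_on U"
    by (simp add: differentiable_on_def bounded_linear_imp_differentiable[OF bounded_linear_vec_nth])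
  ultimately show ?thesis
    by (subst smooth_on_iff) (simp add: smooth_const)
qed

lemma partial_rad:
  assumes "rad x > 0"
  shows "partial \<mu> rad x = (if \<mu> = 0 then 0 else x $ \<mu> / rad x)"
  unfolding partial_eqI[OF has_derivative_rad[OF assms]]
  using exhaust_4[of \<mu>] by (auto simp: axis_def)

lemma vf_apply_rad:
  assumes "rad x > 0"
  shows "vf_apply X rad x = (\<Sum>\<mu>\<in>UNIV. if \<mu> = 0 then 0 else X x $ \<mu> * x $ \<mu>) / rad x"
  by (auto simp: vf_apply_def partial_rad[OF assms] sum_divide_distrib intro!: sum.cong)

lemma rad_square_sum: "(rad x)\<^sup>2 = (\<Sum>\<mu>\<in>UNIV. if \<mu> = 0 then 0 else x $ \<mu> * x $ \<mu>)"
  unfolding rad_square sum_4 by simp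

lemma sum_space_delta:
  "(\<Sum>\<mu>\<in>UNIV. if \<mu> = 0 then 0 else (if \<mu> = i then a else 0) * b \<mu>)
    = (if i = 0 then 0 else a * b i :: real)"
  for i :: 4
proof -
  have "(\<Sum>\<mu>\<in>UNIV. if \<mu> = 0 then 0 else (if \<mu> = i then a else 0) * b \<mu>)
      = (\<Sum>\<mu>\<in>UNIV. if \<mu> = i then (if i = 0 then 0 else a * b i) else 0)"
    by (intro sum.cong) auto
  then show ?thesis by simp
qed

lemma (in open_domain) smooth_rad_square: "smooth_on U (\<lambda>y. (rad y)\<^sup>2)"
  unfolding rad_square by (intro smooth_add smooth_mult smooth_coord)

section \<open>Conformal vector fields\<close>

text \<open>
  The third clause is the conformal Killing equation \<open>\<partial>\<^sup>\<mu>X\<^sup>\<nu> + \<partial>\<^sup>\<nu>X\<^sup>\<mu> = 2\<phi>m\<^sup>\<mu>\<^sup>\<nu>\<close>. The last one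
  requires \<open>\<phi>\<close> to be also the logarithmic derivative of \<open>r\<close> along \<open>X\<close>, which makes \<open>X\<close> a Killing
  field of \<open>r\<^sup>-\<^sup>2 m\<close>.
\<close>

definition conformal_on :: "point set \<Rightarrow> vfield \<Rightarrow> (point \<Rightarrow> real) \<Rightarrow> bool" where
  "conformal_on U X \<phi> \<longleftrightarrow>
     (\<forall>\<mu>. smooth_on U (\<lambda>y. X y $ \<mu>)) \<and> smooth_on U \<phi> \<and>
     (\<forall>x\<in>U. \<forall>\<mu> \<nu>. mink \<mu> \<mu> * partial \<mu> (\<lambda>y. X y $ \<nu>) x + mink \<nu> \<nu> * partial \<nu> (\<lambda>y. X y $ \<mu>) x
        = (if \<mu> = \<nu> then 2 * \<phi> x * mink \<mu> \<mu> else 0)) \<and>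
     (\<forall>x\<in>U. (\<Sum>\<mu>\<in>UNIV. mink \<mu> \<mu> * partial \<mu> (partial \<mu> \<phi>) x) = 0) \<and>
     (\<forall>x\<in>U. vf_apply X rad x = \<phi> x * rad x)"

lemma conformal_onD:
  assumes "conformal_on U X \<phi>"
  shows "smooth_on U (\<lambda>y. X y $ \<mu>)" "smooth_on U \<phi>"
    "x \<in> U \<Longrightarrow> mink \<mu> \<mu> * partial \<mu> (\<lambda>y. X y $ \<nu>) x + mink \<nu> \<nu> * partial \<nu> (\<lambda>y. X y $ \<mu>) x
        = (if \<mu> = \<nu> then 2 * \<phi> x * mink \<mu> \<mu> else 0)"
    "x \<in> U \<Longrightarrow> (\<Sum>\<mu>\<in>UNIV. mink \<mu> \<mu> * partial \<mu> (partial \<mu> \<phi>) x) = 0"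
    "x \<in> U \<Longrightarrow> vf_apply X rad x = \<phi> x * rad x"
  using assms unfolding conformal_on_def by blast+

context open_domain
begin

lemma conformal_trace:
  assumes X: "conformal_on U X \<phi>" and x: "x \<in> U"
  shows "partial \<mu> (\<lambda>y. X y $ \<mu>) x = \<phi> x"
  using conformal_onD(3)[OF X x, of \<mu> \<mu>] by (auto simp: mink_def split: if_splits)

text \<open>
  Differentiating the conformal Killing equation and taking the divergence gives
  \<open>\<box>X\<^sup>\<nu> = 2\<partial>\<^sup>\<nu>\<phi> - \<partial>\<^sup>\<nu>(div X)\<close>, and \<open>div X = 4\<phi>\<close> in four dimensions.
\<close>

lemma conformal_wave:
  assumes X: "conformal_on U X \<phi>" and x: "x \<in> U"
  shows "(\<Sum>\<mu>\<in>UNIV. mink \<mu> \<mu> * partial \<mu> (partial \<mu> (\<lambda>y. X y $ \<nu>)) x) = - 2 * mink \<nu> \<nu> * partial \<nu> \<phi> x"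
proof -
  note sm = conformal_onD(1)[OF X]
  have d: "mink \<mu> \<mu> * partial \<mu> (partial \<mu> (\<lambda>y. X y $ \<nu>)) x + mink \<nu> \<nu> * partial \<nu> \<phi> x
      = (if \<mu> = \<nu> then 2 * mink \<nu> \<nu> * partial \<nu> \<phi> x else 0)" for \<mu>
  proof -
    have "mink \<mu> \<mu> * partial \<mu> (partial \<mu> (\<lambda>y. X y $ \<nu>)) x
        + mink \<nu> \<nu> * partial \<mu> (partial \<nu> (\<lambda>y. X y $ \<mu>)) x
        = partial \<mu> (\<lambda>y. mink \<mu> \<mu> * partial \<mu> (\<lambda>y. X y $ \<nu>) y + mink \<nu> \<nu> * partial \<nu> (\<lambda>y. X y $ \<mu>) y) x"
      by (simp add: partial_add partial_mult partial_const smooth_differentiable smooth_mult smooth_const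
          smooth_partial sm x)
    also have "\<dots> = partial \<mu> (\<lambda>y. if \<mu> = \<nu> then 2 * mink \<mu> \<mu> * \<phi> y else 0) x"
      by (rule partial_transfer[OF _ x]) (simp add: conformal_onD(3)[OF X])
    also have "\<dots> = (if \<mu> = \<nu> then 2 * mink \<nu> \<nu> * partial \<nu> \<phi> x else 0)"
      by (simp add: partial_mult partial_const smooth_differentiable smooth_const conformal_onD(2)[OF X] x)
    also have "partial \<mu> (partial \<nu> (\<lambda>y. X y $ \<mu>)) x = partial \<nu> (partial \<mu> (\<lambda>y. X y $ \<mu>)) x"
      by (rule partial_commute[OF sm x])
    also have "\<dots> = partial \<nu> \<phi> x"
      by (rule partial_transfer[OF conformal_trace[OF X] x])
    finally show ?thesis .
  qed
  have "(\<Sum>\<mu>\<in>UNIV. mink \<mu> \<mu> * partial \<mu> (partial \<mu> (\<lambda>y. X y $ \<nu>)) x + mink \<nu> \<nu> * partial \<nu> \<phi> x)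
      = 2 * mink \<nu> \<nu> * partial \<nu> \<phi> x"
    unfolding d by simp
  then show ?thesis by (simp add: sum.distrib)
qed

lemma vf_apply_radial:
  assumes X: "conformal_on U X \<phi>" and x: "x \<in> U" and pos: "rad x > 0"
  shows "vf_apply X (\<lambda>y. (rad y)\<^sup>2) x = 2 * \<phi> x * (rad x)\<^sup>2"
proof -
  have "partial \<mu> (\<lambda>y. (rad y)\<^sup>2) x = 2 * rad x * partial \<mu> rad x" for \<mu>
    using partial_eqI[OF has_derivative_rad[OF pos]]
      partial_eqI[OF has_derivative_power[OF has_derivative_rad[OF pos], of 2]]
    by simp
  then have "vf_apply X (\<lambda>y. (rad y)\<^sup>2) x = 2 * rad x * vf_apply X rad x"
    by (simp add: vf_apply_def sum_distrib_left mult_ac)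
  then show ?thesis
    using conformal_onD(5)[OF X x] by (simp add: power2_eq_square mult_ac)
qed

end

section \<open>Lie derivatives of one-forms along conformal fields\<close>

definition lie_deriv_form :: "vfield \<Rightarrow> one_form \<Rightarrow> one_form" where
  "lie_deriv_form Y \<omega> x = (\<chi> \<mu>. \<Sum>\<kappa>\<in>UNIV. Y x $ \<kappa> * partial \<kappa> (\<lambda>y. \<omega> y $ \<mu>) x
      + partial \<mu> (\<lambda>y. Y y $ \<kappa>) x * \<omega> x $ \<kappa>)"

lemma (in open_domain) smooth_contr_snd:
  assumes "\<And>\<mu> \<nu>. smooth_on U (\<lambda>y. G y $ \<mu> $ \<nu>)" "\<And>\<mu>. smooth_on U (\<lambda>y. Z y $ \<mu>)"
  shows "smooth_on U (\<lambda>y. contr_snd G Z y $ \<mu>)"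
  unfolding contr_snd_def by (simp, intro smooth_sum smooth_mult assms)

lemma (in open_domain) smooth_lie_bracket:
  assumes "\<And>\<mu>. smooth_on U (\<lambda>y. X y $ \<mu>)" "\<And>\<mu>. smooth_on U (\<lambda>y. Y y $ \<mu>)"
  shows "smooth_on U (\<lambda>y. lie_bracket X Y y $ \<mu>)"
proof -
  have "smooth_on U (\<lambda>y. vf_apply X (\<lambda>z. Y z $ \<mu>) y + (-1) * vf_apply Y (\<lambda>z. X z $ \<mu>) y)"
    unfolding vf_apply_def by (intro smooth_sum smooth_add smooth_mult smooth_const smooth_partial assms)
  then show ?thesis by (simp add: lie_bracket_def)
qed

lemma (in open_domain) smooth_lie_deriv:
  assumes "\<And>\<mu>. smooth_on U (\<lambda>y. Y y $ \<mu>)" "\<And>\<mu> \<nu>. smooth_on U (\<lambda>y. G y $ \<mu> $ \<nu>)"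
  shows "smooth_on U (\<lambda>y. lie_deriv Y G y $ \<mu> $ \<nu>)"
  unfolding lie_deriv_def
  by (simp, intro smooth_sum smooth_add smooth_mult smooth_partial assms)

context open_domain
begin

text \<open>
  The divergence of a one-form involves the inverse metric, which the flow of \<open>Y\<close> rescales; this
  produces the corrections in \<open>\<phi>\<close> to the commutation of the Lie derivative with the divergence.
\<close>

lemma div_lie_deriv_form:
  assumes Y: "conformal_on U Y \<phi>" and \<omega>: "\<And>\<mu>. smooth_on U (\<lambda>y. \<omega> y $ \<mu>)" and x: "x \<in> U"
  shows "div_form (lie_deriv_form Y \<omega>) x = vf_apply Y (div_form \<omega>) x + 2 * \<phi> x * div_form \<omega> x
    - 2 * (\<Sum>\<mu>\<in>UNIV. mink \<mu> \<mu> * \<omega> x $ \<mu> * partial \<mu> \<phi> x)"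
proof -
  note smY = conformal_onD(1)[OF Y]
  note smooth = smooth_sum smooth_add smooth_mult smooth_partial smY \<omega>
  let ?Y = "\<lambda>\<kappa>. Y x $ \<kappa>" and ?w = "\<lambda>\<kappa>. \<omega> x $ \<kappa>"
  let ?dY = "\<lambda>\<mu> \<kappa>. partial \<mu> (\<lambda>y. Y y $ \<kappa>) x" and ?dw = "\<lambda>\<mu> \<kappa>. partial \<mu> (\<lambda>y. \<omega> y $ \<kappa>) x"
  have d: "partial \<mu> (\<lambda>y. lie_deriv_form Y \<omega> y $ \<mu>) x
      = (\<Sum>\<kappa>\<in>UNIV. ?dY \<mu> \<kappa> * (?dw \<kappa> \<mu> + ?dw \<mu> \<kappa>) + ?Y \<kappa> * partial \<kappa> (partial \<mu> (\<lambda>y. \<omega> y $ \<mu>)) x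
        + partial \<mu> (partial \<mu> (\<lambda>y. Y y $ \<kappa>)) x * ?w \<kappa>)" for \<mu>
  proof -
    \<comment> \<open>The product rule gives \<open>\<partial>\<^sub>\<mu>\<partial>\<^sub>\<kappa>\<omega>\<^sub>\<mu>\<close>; the directional derivative of the divergence needs the
      opposite order.\<close>
    have "partial \<mu> (\<lambda>y. lie_deriv_form Y \<omega> y $ \<mu>) x
        = (\<Sum>\<kappa>\<in>UNIV. partial \<mu> (\<lambda>y. Y y $ \<kappa> * partial \<kappa> (\<lambda>y. \<omega> y $ \<mu>) y
            + partial \<mu> (\<lambda>y. Y y $ \<kappa>) y * \<omega> y $ \<kappa>) x)"
      unfolding lie_deriv_form_def by (simp, intro partial_sum smooth x)
    also have "\<dots> = (\<Sum>\<kappa>\<in>UNIV. ?dY \<mu> \<kappa> * (?dw \<kappa> \<mu> + ?dw \<mu> \<kappa>)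
        + ?Y \<kappa> * partial \<mu> (partial \<kappa> (\<lambda>y. \<omega> y $ \<mu>)) x
        + partial \<mu> (partial \<mu> (\<lambda>y. Y y $ \<kappa>)) x * ?w \<kappa>)"
      by (intro sum.cong refl)
        (simp add: partial_add partial_mult smooth_differentiable smooth x algebra_simps)
    finally show ?thesis
      by (simp add: partial_commute[OF \<omega> x])
  qed
  have "div_form (lie_deriv_form Y \<omega>) x
      = (\<Sum>\<mu>\<in>UNIV. \<Sum>\<kappa>\<in>UNIV. (mink \<mu> \<mu> * ?dY \<mu> \<kappa>) * (?dw \<kappa> \<mu> + ?dw \<mu> \<kappa>))
      + (\<Sum>\<mu>\<in>UNIV. \<Sum>\<kappa>\<in>UNIV. ?Y \<kappa> * (mink \<mu> \<mu> * partial \<kappa> (partial \<mu> (\<lambda>y. \<omega> y $ \<mu>)) x))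
      + (\<Sum>\<mu>\<in>UNIV. \<Sum>\<kappa>\<in>UNIV. ?w \<kappa> * (mink \<mu> \<mu> * partial \<mu> (partial \<mu> (\<lambda>y. Y y $ \<kappa>)) x))"
    unfolding div_form_eq d by (simp add: sum.distrib sum_distrib_left algebra_simps)
  also have "(\<Sum>\<mu>\<in>UNIV. \<Sum>\<kappa>\<in>UNIV. (mink \<mu> \<mu> * ?dY \<mu> \<kappa>) * (?dw \<kappa> \<mu> + ?dw \<mu> \<kappa>))
      = 2 * \<phi> x * div_form \<omega> x"
    using symmetrised_contraction[of ?dY "\<phi> x" "\<lambda>\<mu> \<kappa>. ?dw \<kappa> \<mu>"] conformal_onD(3)[OF Y x]
    by (simp add: div_form_eq)
  also have "(\<Sum>\<mu>\<in>UNIV. \<Sum>\<kappa>\<in>UNIV. ?Y \<kappa> * (mink \<mu> \<mu> * partial \<kappa> (partial \<mu> (\<lambda>y. \<omega> y $ \<mu>)) x))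
      = vf_apply Y (div_form \<omega>) x"
    unfolding vf_apply_def div_form_eq[abs_def]
    by (subst sum.swap)
      (simp add: partial_sum partial_mult partial_const smooth_const smooth_differentiable smooth x sum_distrib_left)
  also have "(\<Sum>\<mu>\<in>UNIV. \<Sum>\<kappa>\<in>UNIV. ?w \<kappa> * (mink \<mu> \<mu> * partial \<mu> (partial \<mu> (\<lambda>y. Y y $ \<kappa>)) x))
      = (\<Sum>\<kappa>\<in>UNIV. ?w \<kappa> * (- 2 * mink \<kappa> \<kappa> * partial \<kappa> \<phi> x))"
    by (subst sum.swap) (simp only: sum_distrib_left[symmetric] conformal_wave[OF Y x])
  finally show ?thesis
    by (simp add: sum_distrib_left sum_negf mult_ac)
qed

text \<open>
  The Lie derivative is a derivation that commutes with contractions.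
\<close>

lemma lie_deriv_form_contr_snd:
  assumes Y: "\<And>\<mu>. smooth_on U (\<lambda>y. Y y $ \<mu>)" and X: "\<And>\<mu>. smooth_on U (\<lambda>y. X y $ \<mu>)"
    and G: "\<And>\<mu> \<nu>. smooth_on U (\<lambda>y. G y $ \<mu> $ \<nu>)" and x: "x \<in> U"
  shows "lie_deriv_form Y (contr_snd G X) x $ \<mu>
    = contr_snd G (lie_bracket Y X) x $ \<mu> + contr_snd (lie_deriv Y G) X x $ \<mu>"
proof -
  let ?Y = "\<lambda>\<kappa>. Y x $ \<kappa>" and ?X = "\<lambda>\<kappa>. X x $ \<kappa>" and ?G = "\<lambda>\<mu> \<nu>. G x $ \<mu> $ \<nu>"
  let ?dY = "\<lambda>\<mu> \<kappa>. partial \<mu> (\<lambda>y. Y y $ \<kappa>) x" and ?dX = "\<lambda>\<mu> \<kappa>. partial \<mu> (\<lambda>y. X y $ \<kappa>) x"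
  let ?dG = "\<lambda>\<kappa> \<mu> \<nu>. partial \<kappa> (\<lambda>y. G y $ \<mu> $ \<nu>) x"
  have "partial \<kappa> (\<lambda>y. contr_snd G X y $ \<mu>) x = (\<Sum>\<nu>\<in>UNIV. ?dX \<kappa> \<nu> * ?G \<mu> \<nu> + ?X \<nu> * ?dG \<kappa> \<mu> \<nu>)" for \<kappa>
    unfolding contr_snd_def by (simp add: partial_sum partial_mult smooth_mult smooth_differentiable X G x)
  then have "lie_deriv_form Y (contr_snd G X) x $ \<mu>
      = (\<Sum>\<kappa>\<in>UNIV. \<Sum>\<nu>\<in>UNIV. ?Y \<kappa> * ?dX \<kappa> \<nu> * ?G \<mu> \<nu>)
      + (\<Sum>\<kappa>\<in>UNIV. \<Sum>\<nu>\<in>UNIV. ?Y \<kappa> * ?X \<nu> * ?dG \<kappa> \<mu> \<nu>)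
      + (\<Sum>\<kappa>\<in>UNIV. \<Sum>\<nu>\<in>UNIV. ?dY \<mu> \<kappa> * ?X \<nu> * ?G \<kappa> \<nu>)"
    by (simp add: lie_deriv_form_def contr_snd_def sum.distrib sum_distrib_left algebra_simps)
  moreover have "contr_snd G (lie_bracket Y X) x $ \<mu>
      = (\<Sum>\<nu>\<in>UNIV. \<Sum>\<kappa>\<in>UNIV. ?Y \<kappa> * ?dX \<kappa> \<nu> * ?G \<mu> \<nu>)
      - (\<Sum>\<nu>\<in>UNIV. \<Sum>\<kappa>\<in>UNIV. ?X \<kappa> * ?dY \<kappa> \<nu> * ?G \<mu> \<nu>)"
    by (simp add: contr_snd_def lie_bracket_def vf_apply_def left_diff_distrib sum_subtractf sum_distrib_right)
  moreover have "contr_snd (lie_deriv Y G) X x $ \<mu>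
      = (\<Sum>\<nu>\<in>UNIV. \<Sum>\<kappa>\<in>UNIV. ?Y \<kappa> * ?X \<nu> * ?dG \<kappa> \<mu> \<nu>)
      + (\<Sum>\<nu>\<in>UNIV. \<Sum>\<kappa>\<in>UNIV. ?dY \<mu> \<kappa> * ?X \<nu> * ?G \<kappa> \<nu>)
      + (\<Sum>\<nu>\<in>UNIV. \<Sum>\<kappa>\<in>UNIV. ?X \<nu> * ?dY \<nu> \<kappa> * ?G \<mu> \<kappa>)"
    by (simp add: contr_snd_def lie_deriv_def sum.distrib sum_distrib_left algebra_simps)
  moreover have "(\<Sum>\<nu>\<in>UNIV. \<Sum>\<kappa>\<in>UNIV. ?X \<nu> * ?dY \<nu> \<kappa> * ?G \<mu> \<kappa>)
      = (\<Sum>\<nu>\<in>UNIV. \<Sum>\<kappa>\<in>UNIV. ?X \<kappa> * ?dY \<kappa> \<nu> * ?G \<mu> \<nu>)"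
    by (rule sum.swap)
  ultimately show ?thesis
    using sum.swap[of "\<lambda>\<kappa> \<nu>. ?Y \<kappa> * ?dX \<kappa> \<nu> * ?G \<mu> \<nu>" UNIV UNIV]
      sum.swap[of "\<lambda>\<kappa> \<nu>. ?Y \<kappa> * ?X \<nu> * ?dG \<kappa> \<mu> \<nu>" UNIV UNIV]
      sum.swap[of "\<lambda>\<kappa> \<nu>. ?dY \<mu> \<kappa> * ?X \<nu> * ?G \<kappa> \<nu>" UNIV UNIV]
    by linarith
qed

lemma Q_form_add:
  assumes "\<And>y \<mu>. y \<in> U \<Longrightarrow> \<omega> y $ \<mu> = \<alpha> y $ \<mu> + \<beta> y $ \<mu>"
    and "\<And>\<mu>. smooth_on U (\<lambda>y. \<alpha> y $ \<mu>)" "\<And>\<mu>. smooth_on U (\<lambda>y. \<beta> y $ \<mu>)" and x: "x \<in> U"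
  shows "Q_form A f \<omega> x = Q_form A f \<alpha> x + Q_form A f \<beta> x"
proof -
  have "partial \<mu> (\<lambda>y. \<omega> y $ \<mu>) x = partial \<mu> (\<lambda>y. \<alpha> y $ \<mu>) x + partial \<mu> (\<lambda>y. \<beta> y $ \<mu>) x" for \<mu>
    using partial_transfer[of "\<lambda>y. \<omega> y $ \<mu>" "\<lambda>y. \<alpha> y $ \<mu> + \<beta> y $ \<mu>" x \<mu>] assms
    by (simp add: partial_add smooth_differentiable)
  then show ?thesis
    using assms(1)[OF x]
    by (simp add: Q_form_def div_form_eq sum.distrib algebra_simps)
qed

end

section \<open>Covariant derivatives\<close>

locale gauge_potential = open_domain +
  fixes A :: one_form
  assumes smooth_A: "smooth_on U (\<lambda>y. A y $ \<mu>)"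
begin

lemmas partial_of_real = partial_linear[OF bounded_linear_of_real]
lemmas smooth_of_real = smooth_linear[OF bounded_linear_of_real]

lemmas smooth_intros = smooth_const smooth_add smooth_mult smooth_sum smooth_of_real smooth_partial smooth_A

lemma smooth_cov:
  assumes "smooth_on U f"
  shows "smooth_on U (cov A \<mu> f)"
  unfolding cov_def[abs_def] by (intro smooth_intros assms)

lemma cov_transfer:
  assumes "\<And>y. y \<in> U \<Longrightarrow> f y = g y" "x \<in> U"
  shows "cov A \<mu> f x = cov A \<mu> g x"
  using assms partial_transfer[OF assms] by (simp add: cov_def)

lemma cov_add:
  assumes "smooth_on U f" "smooth_on U g" "x \<in> U"
  shows "cov A \<mu> (\<lambda>y. f y + g y) x = cov A \<mu> f x + cov A \<mu> g x"
  using assms by (simp add: cov_def partial_add smooth_differentiable algebra_simps)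

lemma cov_sum:
  assumes "\<And>i. i \<in> I \<Longrightarrow> smooth_on U (f i)" "x \<in> U"
  shows "cov A \<mu> (\<lambda>y. \<Sum>i\<in>I. f i y) x = (\<Sum>i\<in>I. cov A \<mu> (f i) x)"
  using assms by (simp add: cov_def partial_sum sum.distrib sum_distrib_left)

lemma cov_scale:
  assumes "smooth_on U f" "x \<in> U"
  shows "cov A \<mu> (\<lambda>y. c * f y) x = c * cov A \<mu> f x"
  using assms by (simp add: cov_def partial_mult partial_const smooth_differentiable algebra_simps)

lemma cov_mult:
  assumes "smooth_on U g" "smooth_on U f" "x \<in> U"
  shows "cov A \<mu> (\<lambda>y. of_real (g y) * f y) x = of_real (partial \<mu> g x) * f x + of_real (g x) * cov A \<mu> f x"
  using assms
  by (simp add: cov_def partial_mult partial_of_real smooth_of_real smooth_differentiable algebra_simps)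

text \<open>
  Curvature is the failure of covariant derivatives to commute; the second partial derivatives of
  \<open>f\<close> and the terms quadratic in \<open>A\<close> cancel.
\<close>

lemma cov_commute:
  assumes f: "smooth_on U f" and x: "x \<in> U"
  shows "cov A \<mu> (cov A \<nu> f) x
    = cov A \<nu> (cov A \<mu> f) x + \<i> * of_real (ext_deriv A x $ \<mu> $ \<nu>) * f x"
proof -
  have expand: "cov A \<alpha> (cov A \<beta> f) x = partial \<alpha> (partial \<beta> f) x
      + \<i> * of_real (A x $ \<alpha>) * partial \<beta> f x
      + \<i> * (of_real (partial \<alpha> (\<lambda>y. A y $ \<beta>) x) * f x + of_real (A x $ \<beta>) * cov A \<alpha> f x)" for \<alpha> \<beta>
  proof -
    have "cov A \<beta> f = (\<lambda>y. partial \<beta> f y + \<i> * (of_real (A y $ \<beta>) * f y))"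
      by (simp add: cov_def fun_eq_iff)
    then have "cov A \<alpha> (cov A \<beta> f) x
        = cov A \<alpha> (partial \<beta> f) x + cov A \<alpha> (\<lambda>y. \<i> * (of_real (A y $ \<beta>) * f y)) x"
      using cov_add[OF smooth_partial[OF f] _ x, of "\<lambda>y. \<i> * (of_real (A y $ \<beta>) * f y)"]
      by (simp add: smooth_intros f)
    also have "cov A \<alpha> (\<lambda>y. \<i> * (of_real (A y $ \<beta>) * f y)) x
        = \<i> * (of_real (partial \<alpha> (\<lambda>y. A y $ \<beta>) x) * f x + of_real (A x $ \<beta>) * cov A \<alpha> f x)"
      by (simp add: cov_scale cov_mult smooth_intros f x)
    finally show ?thesis by (simp add: cov_def[of A \<alpha> "partial \<beta> f" x])
  qed
  show ?thesis
    unfolding expand partial_commute[OF f x, of \<mu> \<nu>]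
    by (simp add: cov_def ext_deriv_def algebra_simps)
qed

lemma smooth_cov_vf:
  assumes "\<And>\<mu>. smooth_on U (\<lambda>y. X y $ \<mu>)" "smooth_on U f"
  shows "smooth_on U (cov_vf A X f)"
  unfolding cov_vf_def[abs_def] by (intro smooth_intros smooth_cov assms)

lemma smooth_ext_deriv: "smooth_on U (\<lambda>y. ext_deriv A y $ \<mu> $ \<nu>)"
proof -
  have "smooth_on U (\<lambda>y. partial \<mu> (\<lambda>y. A y $ \<nu>) y + (-1) * partial \<nu> (\<lambda>y. A y $ \<mu>) y)"
    by (intro smooth_intros)
  then show ?thesis by (simp add: ext_deriv_def)
qed

lemma cov_cov_vf:
  assumes X: "\<And>\<mu>. smooth_on U (\<lambda>y. X y $ \<mu>)" and f: "smooth_on U f" and x: "x \<in> U"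
  shows "cov A \<mu> (cov_vf A X f) x = cov_vf A X (cov A \<mu> f) x
    + (\<Sum>\<nu>\<in>UNIV. of_real (partial \<mu> (\<lambda>y. X y $ \<nu>) x) * cov A \<nu> f x)
    + \<i> * of_real (contr_snd (ext_deriv A) X x $ \<mu>) * f x"
proof -
  have "cov A \<mu> (cov_vf A X f) x = (\<Sum>\<nu>\<in>UNIV. cov A \<mu> (\<lambda>y. of_real (X y $ \<nu>) * cov A \<nu> f y) x)"
    unfolding cov_vf_def[abs_def] by (intro cov_sum smooth_intros smooth_cov X f x)
  also have "\<dots> = (\<Sum>\<nu>\<in>UNIV. of_real (partial \<mu> (\<lambda>y. X y $ \<nu>) x) * cov A \<nu> f x
      + of_real (X x $ \<nu>) * (cov A \<nu> (cov A \<mu> f) x + \<i> * of_real (ext_deriv A x $ \<mu> $ \<nu>) * f x))"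
    by (simp add: cov_mult smooth_cov X f x cov_commute[of f x \<mu>])
  finally show ?thesis
    by (simp add: cov_vf_def contr_snd_def sum.distrib distrib_left sum_distrib_left sum_distrib_right mult_ac)
qed

end

section \<open>Commutators with conformal vector fields\<close>

text \<open>
  Away from the axis \<open>r = 0\<close> the zeroth-order coefficient \<open>X(r)/r\<close> of \<open>cov_hat\<close> is the conformal factor.
\<close>

locale off_axis_potential = gauge_potential +
  assumes rad_pos: "x \<in> U \<Longrightarrow> rad x > 0"
begin

lemma cov_hat_eq:
  assumes "conformal_on U X \<phi>" "x \<in> U"
  shows "cov_hat A X f x = cov_vf A X f x + of_real (\<phi> x) * f x"
  using conformal_onD(5)[OF assms] rad_pos[OF assms(2)] by (simp add: cov_hat_def)

lemma smooth_cov_hat: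
  assumes X: "conformal_on U X \<phi>" and f: "smooth_on U f"
  shows "smooth_on U (cov_hat A X f)"
proof (rule smooth_on_transfer)
  show "smooth_on U (\<lambda>y. cov_vf A X f y + of_real (\<phi> y) * f y)"
    by (intro smooth_intros smooth_cov_vf conformal_onD[OF X] f)
qed (simp add: cov_hat_eq[OF X])

lemma cov_hat_transfer:
  assumes "\<And>y. y \<in> U \<Longrightarrow> f y = g y" "x \<in> U"
  shows "cov_hat A X f x = cov_hat A X g x"
  using assms(1)[OF assms(2)] cov_transfer[OF assms] by (simp add: cov_hat_def cov_vf_def)

lemma cov_hat_add:
  assumes "smooth_on U f" "smooth_on U g" "x \<in> U"
  shows "cov_hat A X (\<lambda>y. f y + g y) x = cov_hat A X f x + cov_hat A X g x"
  using assms by (simp add: cov_hat_def cov_vf_def cov_add sum.distrib algebra_simps add_divide_distrib)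

lemma cov_hat_scale:
  assumes "smooth_on U f" "x \<in> U"
  shows "cov_hat A X (\<lambda>y. c * f y) x = c * cov_hat A X f x"
  unfolding cov_hat_def cov_vf_def cov_scale[OF assms]
  by (simp add: sum_distrib_left algebra_simps)

lemma cov_hat_sum:
  assumes "\<And>i. i \<in> I \<Longrightarrow> smooth_on U (f i)" "x \<in> U" "finite I"
  shows "cov_hat A X (\<lambda>y. \<Sum>i\<in>I. f i y) x = (\<Sum>i\<in>I. cov_hat A X (f i) x)"
  using assms(3,1)
proof (induction I)
  case empty
  then show ?case by (simp add: cov_hat_def cov_vf_def cov_def partial_const)
next
  case (insert i I)
  then show ?case
    using cov_hat_add[of "f i" "\<lambda>y. \<Sum>i\<in>I. f i y" x X] assms(2) by (simp add: smooth_sum)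
qed

lemma cov_hat_mult:
  assumes "smooth_on U g" "smooth_on U f" "x \<in> U"
  shows "cov_hat A X (\<lambda>y. of_real (g y) * f y) x
    = of_real (vf_apply X g x) * f x + of_real (g x) * cov_hat A X f x"
  unfolding cov_hat_def cov_vf_def cov_mult[OF assms]
  by (simp add: vf_apply_def sum.distrib sum_distrib_left sum_distrib_right algebra_simps)

lemma cov_cov_hat:
  assumes X: "conformal_on U X \<phi>" and f: "smooth_on U f" and x: "x \<in> U"
  shows "cov A \<mu> (cov_hat A X f) x = cov_hat A X (cov A \<mu> f) x
    + (\<Sum>\<nu>\<in>UNIV. of_real (partial \<mu> (\<lambda>y. X y $ \<nu>) x) * cov A \<nu> f x)
    + (\<i> * of_real (contr_snd (ext_deriv A) X x $ \<mu>) + of_real (partial \<mu> \<phi> x)) * f x"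
proof -
  note smX = conformal_onD(1,2)[OF X]
  have "cov A \<mu> (cov_hat A X f) x = cov A \<mu> (\<lambda>y. cov_vf A X f y + of_real (\<phi> y) * f y) x"
    by (rule cov_transfer[OF cov_hat_eq[OF X] x])
  also have "\<dots> = cov A \<mu> (cov_vf A X f) x + of_real (partial \<mu> \<phi> x) * f x + of_real (\<phi> x) * cov A \<mu> f x"
    by (simp add: cov_add cov_mult smooth_intros smooth_cov_vf smX f x)
  finally show ?thesis
    by (simp add: cov_cov_vf[OF smX(1) f x] cov_hat_eq[OF X x] algebra_simps)
qed

text \<open>
  The second-order terms collapse by \<open>symmetrised_contraction\<close>; the two first-order terms without
  curvature cancel by \<open>conformal_wave\<close>; the zeroth-order term \<open>(\<box>\<phi>) f\<close> vanishes.
\<close>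

lemma Box_cov_hat:
  assumes X: "conformal_on U X \<phi>" and f: "smooth_on U f" and x: "x \<in> U"
  shows "Box A (cov_hat A X f) x = cov_hat A X (Box A f) x + 2 * of_real (\<phi> x) * Box A f x
    + Q_form A f (contr_snd (ext_deriv A) X) x"
proof -
  note smX = conformal_onD(1,2)[OF X]
  let ?w = "\<lambda>\<mu> y. contr_snd (ext_deriv A) X y $ \<mu>"
  let ?D = "\<lambda>\<mu>. cov A \<mu> f" and ?DD = "\<lambda>\<mu> \<nu>. cov A \<mu> (cov A \<nu> f) x"
  let ?dX = "\<lambda>\<mu> \<nu>. partial \<mu> (\<lambda>y. X y $ \<nu>)"
  note smooth = smooth_intros smooth_cov smooth_cov_hat[OF X] smX f smooth_contr_snd smooth_ext_deriv
  have DD: "cov A \<mu> (cov A \<mu> (cov_hat A X f)) x = cov_hat A X (cov A \<mu> (?D \<mu>)) x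
      + (\<Sum>\<nu>\<in>UNIV. of_real (?dX \<mu> \<nu> x) * (?DD \<mu> \<nu> + ?DD \<nu> \<mu>))
      + (\<Sum>\<nu>\<in>UNIV. of_real (partial \<mu> (?dX \<mu> \<nu>) x) * ?D \<nu> x)
      + 2 * (\<i> * of_real (?w \<mu> x) + of_real (partial \<mu> \<phi> x)) * ?D \<mu> x
      + (\<i> * of_real (partial \<mu> (?w \<mu>) x) + of_real (partial \<mu> (partial \<mu> \<phi>) x)) * f x" for \<mu>
  proof -
    have "cov A \<mu> (cov A \<mu> (cov_hat A X f)) x = cov A \<mu> (\<lambda>y. cov_hat A X (?D \<mu>) y
        + (\<Sum>\<nu>\<in>UNIV. of_real (?dX \<mu> \<nu> y) * ?D \<nu> y)
        + \<i> * (of_real (?w \<mu> y) * f y) + of_real (partial \<mu> \<phi> y) * f y) x"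
      by (rule cov_transfer[OF _ x]) (simp add: cov_cov_hat[OF X f] algebra_simps)
    also have "\<dots> = cov A \<mu> (cov_hat A X (?D \<mu>)) x
        + (\<Sum>\<nu>\<in>UNIV. of_real (partial \<mu> (?dX \<mu> \<nu>) x) * ?D \<nu> x + of_real (?dX \<mu> \<nu> x) * ?DD \<mu> \<nu>)
        + \<i> * (of_real (partial \<mu> (?w \<mu>) x) * f x + of_real (?w \<mu> x) * ?D \<mu> x)
        + (of_real (partial \<mu> (partial \<mu> \<phi>) x) * f x + of_real (partial \<mu> \<phi> x) * ?D \<mu> x)"
      by (simp add: cov_add cov_sum cov_mult cov_scale smooth x)
    also have "cov A \<mu> (cov_hat A X (?D \<mu>)) x = cov_hat A X (cov A \<mu> (?D \<mu>)) x
        + (\<Sum>\<nu>\<in>UNIV. of_real (?dX \<mu> \<nu> x) * ?DD \<nu> \<mu>)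
        + (\<i> * of_real (?w \<mu> x) + of_real (partial \<mu> \<phi> x)) * ?D \<mu> x"
      by (rule cov_cov_hat[OF X smooth_cov[OF f] x])
    finally show ?thesis
      by (simp add: sum.distrib algebra_simps)
  qed
  have hat: "cov_hat A X (Box A f) x = (\<Sum>\<mu>\<in>UNIV. of_real (mink \<mu> \<mu>) * cov_hat A X (cov A \<mu> (?D \<mu>)) x)"
    unfolding Box_eq by (simp add: cov_hat_sum cov_hat_scale smooth x)
  have second: "(\<Sum>\<mu>\<in>UNIV. of_real (mink \<mu> \<mu>) * (\<Sum>\<nu>\<in>UNIV. of_real (?dX \<mu> \<nu> x) * (?DD \<mu> \<nu> + ?DD \<nu> \<mu>)))
      = 2 * of_real (\<phi> x) * Box A f x"
    using symmetrised_contraction[of "\<lambda>\<mu> \<nu>. ?dX \<mu> \<nu> x" "\<phi> x" ?DD] conformal_onD(3)[OF X x]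
    by (simp add: Box_eq sum_distrib_left mult.assoc)
  \<comment> \<open>The right-hand side cancels the term \<open>2 \<partial>\<^sup>\<mu>\<phi> D\<^sub>\<mu>f\<close> that comes from \<open>\<box>\<^sub>A (\<phi> f)\<close>.\<close>
  have first: "(\<Sum>\<mu>\<in>UNIV. of_real (mink \<mu> \<mu>) * (\<Sum>\<nu>\<in>UNIV. of_real (partial \<mu> (?dX \<mu> \<nu>) x) * ?D \<nu> x))
      = - (\<Sum>\<nu>\<in>UNIV. of_real (mink \<nu> \<nu>) * (2 * of_real (partial \<nu> \<phi> x) * ?D \<nu> x))"
  proof -
    have "(\<Sum>\<mu>\<in>UNIV. of_real (mink \<mu> \<mu>) * (\<Sum>\<nu>\<in>UNIV. of_real (partial \<mu> (?dX \<mu> \<nu>) x) * ?D \<nu> x))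
        = (\<Sum>\<nu>\<in>UNIV. of_real (\<Sum>\<mu>\<in>UNIV. mink \<mu> \<mu> * partial \<mu> (?dX \<mu> \<nu>) x) * ?D \<nu> x)"
      unfolding sum_distrib_left by (subst sum.swap) (simp add: sum_distrib_right mult.assoc)
    then show ?thesis
      unfolding conformal_wave[OF X x] by (simp add: sum_negf mult_ac)
  qed
  have zeroth: "(\<Sum>\<mu>\<in>UNIV. of_real (mink \<mu> \<mu>) * (of_real (partial \<mu> (partial \<mu> \<phi>) x) * f x)) = 0"
    using arg_cong[OF conformal_onD(4)[OF X x], of "\<lambda>r. of_real r * f x"]
    by (simp add: sum_distrib_right mult.assoc)
  have "Box A (cov_hat A X f) x = cov_hat A X (Box A f) x + 2 * of_real (\<phi> x) * Box A f x
      + (\<Sum>\<mu>\<in>UNIV. of_real (mink \<mu> \<mu>) * (2 * \<i> * of_real (?w \<mu> x) * ?D \<mu> x))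
      + (\<Sum>\<mu>\<in>UNIV. of_real (mink \<mu> \<mu>) * (\<i> * of_real (partial \<mu> (?w \<mu>) x) * f x))"
    unfolding hat second[symmetric]
    using first zeroth
    by (simp add: Box_eq[of A "cov_hat A X f"] DD distrib_left distrib_right sum.distrib mult.assoc)
  then show ?thesis
    by (simp add: Q_form_def div_form_eq sum_distrib_left sum_distrib_right mult_ac)
qed

text \<open>
  The weight \<open>r\<^sup>2\<close> is chosen so that \<open>X(r\<^sup>2) = 2\<phi>r\<^sup>2\<close> cancels the conformal rescaling of \<open>\<box>\<^sub>A\<close>.
\<close>

lemma r2Box_commutator:
  assumes X: "conformal_on U X \<phi>" and f: "smooth_on U f" and x: "x \<in> U"
  shows "commutator (r2Box A) (cov_hat A X) f x
    = of_real ((rad x)\<^sup>2) * Q_form A f (contr_snd (ext_deriv A) X) x"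
proof -
  have r2: "smooth_on U (\<lambda>y. (rad y)\<^sup>2)"
    unfolding rad_square by (intro smooth_add smooth_mult smooth_coord)
  have box: "smooth_on U (Box A f)"
    unfolding Box_eq by (intro smooth_intros smooth_cov f)
  have "cov_hat A X (r2Box A f) x
      = of_real (2 * \<phi> x * (rad x)\<^sup>2) * Box A f x + of_real ((rad x)\<^sup>2) * cov_hat A X (Box A f) x"
    unfolding r2Box_def[abs_def] cov_hat_mult[OF r2 box x] vf_apply_radial[OF X x rad_pos[OF x]] ..
  then show ?thesis
    by (simp add: commutator_def r2Box_def Box_cov_hat[OF X f x] algebra_simps)
qed

text \<open>
  This is the commutator of \<open>D\<^sub>Y + \<phi>\<close> with \<open>r\<^sup>2 Q[\<omega>]\<close>, divided by \<open>r\<^sup>2\<close>; the term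
  \<open>2\<phi> Q[\<omega>] f\<close> comes from differentiating \<open>r\<^sup>2\<close>. In \<open>Q[\<omega>] (D\<^sub>Y + \<phi>) f\<close>, moving \<open>D\<^sub>\<mu>\<close> past \<open>D\<^sub>Y + \<phi>\<close>
  produces a curvature term, which becomes the one quadratic in \<open>F\<close>, and a term \<open>\<partial>\<^sub>\<mu>\<phi>\<close>, which matches
  the correction in \<open>div_lie_deriv_form\<close>.
\<close>

lemma cov_hat_Q_form:
  assumes Y: "conformal_on U Y \<phi>" and \<omega>: "\<And>\<mu>. smooth_on U (\<lambda>y. \<omega> y $ \<mu>)"
    and f: "smooth_on U f" and x: "x \<in> U"
  shows "cov_hat A Y (Q_form A f \<omega>) x + 2 * of_real (\<phi> x) * Q_form A f \<omega> x
      - Q_form A (cov_hat A Y f) \<omega> x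
    = Q_form A f (lie_deriv_form Y \<omega>) x
      + 2 * of_real (\<Sum>\<mu>\<in>UNIV. mink \<mu> \<mu> * \<omega> x $ \<mu> * contr_snd (ext_deriv A) Y x $ \<mu>) * f x"
proof -
  note smY = conformal_onD(1,2)[OF Y]
  note smooth = smooth_intros smooth_cov smooth_cov_hat[OF Y] smY f \<omega>
  let ?w = "\<lambda>\<mu>. \<omega> x $ \<mu>" and ?D = "\<lambda>\<mu>. cov A \<mu> f x"
  let ?dY = "\<lambda>\<mu> \<nu>. partial \<mu> (\<lambda>y. Y y $ \<nu>) x"
  let ?FY = "\<lambda>\<mu>. contr_snd (ext_deriv A) Y x $ \<mu>"
  have smdiv: "smooth_on U (div_form \<omega>)"
    unfolding div_form_eq[abs_def] by (intro smooth)
  have Yw: "vf_apply Y (\<lambda>y. mink \<mu> \<mu> * \<omega> y $ \<mu>) x = mink \<mu> \<mu> * vf_apply Y (\<lambda>y. \<omega> y $ \<mu>) x" for \<mu>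
    by (simp add: vf_apply_def partial_mult partial_const smooth_differentiable smooth x sum_distrib_left mult_ac)
  have 1: "cov_hat A Y (Q_form A f \<omega>) x
      = 2 * \<i> * (\<Sum>\<mu>\<in>UNIV. of_real (mink \<mu> \<mu> * vf_apply Y (\<lambda>y. \<omega> y $ \<mu>) x) * ?D \<mu>
          + of_real (mink \<mu> \<mu> * ?w \<mu>) * cov_hat A Y (cov A \<mu> f) x)
        + \<i> * (of_real (vf_apply Y (div_form \<omega>) x) * f x + of_real (div_form \<omega> x) * cov_hat A Y f x)"
  proof -
    have "Q_form A f \<omega> = (\<lambda>y. 2 * \<i> * (\<Sum>\<mu>\<in>UNIV. of_real (mink \<mu> \<mu> * \<omega> y $ \<mu>) * cov A \<mu> f y)
        + \<i> * (of_real (div_form \<omega> y) * f y))"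
      by (simp add: Q_form_def fun_eq_iff)
    moreover have "smooth_on U (\<lambda>y. \<Sum>\<mu>\<in>UNIV. of_real (mink \<mu> \<mu> * \<omega> y $ \<mu>) * cov A \<mu> f y)"
      by (intro smooth)
    moreover have "smooth_on U (\<lambda>y. of_real (mink \<mu> \<mu> * \<omega> y $ \<mu>) * cov A \<mu> f y)"
      "smooth_on U (\<lambda>y. mink \<mu> \<mu> * \<omega> y $ \<mu>)" for \<mu>
      by (intro smooth)+
    moreover have "smooth_on U (\<lambda>y. of_real (div_form \<omega> y) * f y)"
      by (intro smooth smdiv)
    ultimately show ?thesis
      using smooth_cov[OF f] smdiv f x
      by (simp only: cov_hat_add cov_hat_scale cov_hat_sum cov_hat_mult Yw smooth_mult smooth_const
          finite_class.finite_UNIV)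
  qed
  have 2: "Q_form A (cov_hat A Y f) \<omega> x
      = 2 * \<i> * (\<Sum>\<mu>\<in>UNIV. of_real (mink \<mu> \<mu> * ?w \<mu>) * (cov_hat A Y (cov A \<mu> f) x
          + (\<Sum>\<nu>\<in>UNIV. of_real (?dY \<mu> \<nu>) * ?D \<nu>) + (\<i> * of_real (?FY \<mu>) + of_real (partial \<mu> \<phi> x)) * f x))
        + \<i> * of_real (div_form \<omega> x) * cov_hat A Y f x"
    unfolding Q_form_def cov_cov_hat[OF Y f x] ..
  \<comment> \<open>The conformal Killing equation turns \<open>- \<omega>\<^sub>\<mu>\<partial>\<^sup>\<mu>Y\<^sup>\<nu>\<close>, which arises when \<open>D\<^sub>\<mu>\<close> moves past \<open>D\<^sub>Y\<close>, into
    \<open>\<omega>\<^sub>\<mu>\<partial>\<^sup>\<nu>Y\<^sup>\<mu>\<close>, the second half of the Lie derivative, up to a multiple of \<open>\<phi>\<close>.\<close>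
  have lie: "mink \<nu> \<nu> * lie_deriv_form Y \<omega> x $ \<nu> = mink \<nu> \<nu> * vf_apply Y (\<lambda>y. \<omega> y $ \<nu>) x
      + 2 * \<phi> x * (mink \<nu> \<nu> * ?w \<nu>) - (\<Sum>\<mu>\<in>UNIV. mink \<mu> \<mu> * ?w \<mu> * ?dY \<mu> \<nu>)" for \<nu>
  proof -
    have "(\<Sum>\<mu>\<in>UNIV. (mink \<mu> \<mu> * ?dY \<mu> \<nu> + mink \<nu> \<nu> * ?dY \<nu> \<mu>) * ?w \<mu>) = 2 * \<phi> x * (mink \<nu> \<nu> * ?w \<nu>)"
      unfolding conformal_onD(3)[OF Y x] by (simp add: if_distrib[of "\<lambda>z. z * _"] cong: if_cong)
    then show ?thesis
      by (simp add: lie_deriv_form_def vf_apply_def sum.distrib sum_distrib_left algebra_simps)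
  qed
  have swap: "(\<Sum>\<mu>\<in>UNIV. of_real (mink \<mu> \<mu> * ?w \<mu>) * (\<Sum>\<nu>\<in>UNIV. of_real (?dY \<mu> \<nu>) * ?D \<nu>))
      = (\<Sum>\<nu>\<in>UNIV. of_real (\<Sum>\<mu>\<in>UNIV. mink \<mu> \<mu> * ?w \<mu> * ?dY \<mu> \<nu>) * ?D \<nu>)"
    unfolding sum_distrib_left by (subst sum.swap) (simp add: sum_distrib_right mult.assoc)
  have 3: "Q_form A f (lie_deriv_form Y \<omega>) x
      = 2 * \<i> * ((\<Sum>\<nu>\<in>UNIV. of_real (mink \<nu> \<nu> * vf_apply Y (\<lambda>y. \<omega> y $ \<nu>) x) * ?D \<nu>)
          + 2 * of_real (\<phi> x) * (\<Sum>\<nu>\<in>UNIV. of_real (mink \<nu> \<nu> * ?w \<nu>) * ?D \<nu>)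
          - (\<Sum>\<mu>\<in>UNIV. of_real (mink \<mu> \<mu> * ?w \<mu>) * (\<Sum>\<nu>\<in>UNIV. of_real (?dY \<mu> \<nu>) * ?D \<nu>)))
        + \<i> * of_real (vf_apply Y (div_form \<omega>) x + 2 * \<phi> x * div_form \<omega> x
            - 2 * (\<Sum>\<mu>\<in>UNIV. mink \<mu> \<mu> * ?w \<mu> * partial \<mu> \<phi> x)) * f x"
    unfolding Q_form_def div_lie_deriv_form[OF Y \<omega> x] lie swap
    by (simp add: sum.distrib sum_subtractf sum_distrib_left algebra_simps)
  show ?thesis
    unfolding 1 2 3 Q_form_def[of A f \<omega>]
    by (simp add: sum.distrib sum_negf sum_distrib_left sum_distrib_right algebra_simps)
qed

end

section \<open>The commutator vector fields are conformal\<close>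

context open_domain
begin

lemma conformal_on_transfer:
  assumes X: "conformal_on U X \<phi>" and eq: "\<And>y. y \<in> U \<Longrightarrow> X y = Z y"
  shows "conformal_on U Z \<phi>"
proof -
  have "partial \<mu> (\<lambda>y. X y $ \<nu>) x = partial \<mu> (\<lambda>y. Z y $ \<nu>) x" if "x \<in> U" for \<mu> \<nu> x
    using that eq by (intro partial_transfer) auto
  moreover have "smooth_on U (\<lambda>y. Z y $ \<mu>)" for \<mu>
    using eq by (intro smooth_on_transfer[OF _ conformal_onD(1)[OF X, of \<mu>]]) auto
  moreover have "vf_apply X rad x = vf_apply Z rad x" if "x \<in> U" for x
    using that eq by (simp add: vf_apply_def)
  ultimately show ?thesis
    using X unfolding conformal_on_def by simp
qed

lemma conformal_T:
  assumes "\<And>x. x \<in> U \<Longrightarrow> rad x > 0"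
  shows "conformal_on U T_vf (\<lambda>x. 0)"
  unfolding conformal_on_def
  using assms by (auto simp: T_vf_def d_t_def partial_const[abs_def] smooth_const vf_apply_rad axis_def
      intro!: sum.neutral)

lemma conformal_Omega:
  assumes pos: "\<And>x. x \<in> U \<Longrightarrow> rad x > 0" and ij: "i \<noteq> 0" "j \<noteq> 0"
  shows "conformal_on U (Omega_vf i j) (\<lambda>x. 0)"
proof -
  have comp: "Omega_vf i j y $ \<mu> = y $ i * (if \<mu> = j then 1 else 0) + y $ j * (if \<mu> = i then -1 else 0)" for y \<mu>
    by (simp add: Omega_vf_def axis_def)
  \<comment> \<open>The coefficients are variables here so that the conditionals in the components stay outside the
    differentiation.\<close>
  have linear: "partial \<nu> (\<lambda>y. y $ i * c + y $ j * d) x = (if \<nu> = i then c else 0) + (if \<nu> = j then d else 0)"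
    if "x \<in> U" for \<nu> x c d
    using that
    by (simp add: partial_add partial_mult partial_const partial_coord smooth_differentiable smooth_mult
        smooth_const smooth_coord)
  have "mink \<mu> \<mu> * partial \<mu> (\<lambda>y. Omega_vf i j y $ \<nu>) x
      + mink \<nu> \<nu> * partial \<nu> (\<lambda>y. Omega_vf i j y $ \<mu>) x = 0" if "x \<in> U" for \<mu> \<nu> x
    unfolding comp linear[OF that] mink_def using ij
    by (cases "\<mu> = i"; cases "\<mu> = j"; cases "\<nu> = i"; cases "\<nu> = j"; simp)
  moreover have "smooth_on U (\<lambda>y. Omega_vf i j y $ \<mu>)" for \<mu>
    unfolding comp by (intro smooth_add smooth_mult smooth_coord smooth_const)
  moreover have "vf_apply (Omega_vf i j) rad x = 0" if "x \<in> U" for x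
  proof -
    have "(\<Sum>\<mu>\<in>UNIV. if \<mu> = 0 then 0 else Omega_vf i j x $ \<mu> * x $ \<mu>)
      = (\<Sum>\<mu>\<in>UNIV. (if \<mu> = 0 then 0 else (if \<mu> = j then x $ i else 0) * x $ \<mu>)
          + (if \<mu> = 0 then 0 else (if \<mu> = i then - x $ j else 0) * x $ \<mu>))"
      by (intro sum.cong) (auto simp: comp algebra_simps)
    then show ?thesis
      unfolding vf_apply_rad[OF pos[OF that]] sum.distrib sum_space_delta using ij by simp
  qed
  ultimately show ?thesis
    unfolding conformal_on_def by (simp add: partial_const[abs_def] smooth_const)
qed

text \<open>
  Away from the axis \<open>S\<close> is the Euler field \<open>x\<^sup>\<mu>\<partial>\<^sub>\<mu>\<close>: \<open>v + u = t\<close> and \<open>v - u = r\<close>.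
\<close>

lemma conformal_S:
  assumes pos: "\<And>x. x \<in> U \<Longrightarrow> rad x > 0"
  shows "conformal_on U S_vf (\<lambda>x. 1)"
proof (rule conformal_on_transfer)
  show "conformal_on U (\<lambda>y. y) (\<lambda>x. 1)"
    unfolding conformal_on_def
    by (auto simp: partial_coord partial_const[abs_def] smooth_const smooth_coord vf_apply_rad pos mink_def
        rad_square_sum[symmetric] power2_eq_square)
  fix y assume "y \<in> U"
  with pos have "rad y \<noteq> 0" by fastforce
  then show "y = S_vf y"
    by (simp add: vec_eq_iff S_vf_def L_vf_def Lbar_vf_def d_t_def d_r_def u_coord_def v_coord_def
        axis_def field_simps)
qed

text \<open>
  Away from the axis \<open>K\<close> has the polynomial components \<open>t x\<^sup>\<mu> + (r\<^sup>2 - t\<^sup>2)/2 \<delta>\<^sup>\<mu>\<^sub>0\<close>, because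
  \<open>v\<^sup>2 + u\<^sup>2 = (t\<^sup>2 + r\<^sup>2)/2\<close> and \<open>v\<^sup>2 - u\<^sup>2 = t r\<close>.
\<close>

lemma conformal_K:
  assumes pos: "\<And>x. x \<in> U \<Longrightarrow> rad x > 0"
  shows "conformal_on U K_vf (\<lambda>x. x $ 0)"
proof (rule conformal_on_transfer)
  define K :: vfield where
    "K y = (\<chi> \<mu>. y $ 0 * y $ \<mu> + (if \<mu> = 0 then 1 / 2 else 0) * ((rad y)\<^sup>2 + (-1) * (y $ 0 * y $ 0)))" for y
  have comp: "K y $ \<mu> = y $ 0 * y $ \<mu> + (if \<mu> = 0 then 1 / 2 else 0)
      * (y $ 1 * y $ 1 + y $ 2 * y $ 2 + y $ 3 * y $ 3 + (-1) * (y $ 0 * y $ 0))" for y \<mu>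
    by (simp add: K_def rad_square)
  note smooth = smooth_add smooth_mult smooth_const smooth_coord
  \<comment> \<open>As for the rotations, the coefficients are variables while the derivative is computed.\<close>
  have quadratic: "partial \<nu> (\<lambda>y. y $ 0 * y $ \<mu>
        + c * (y $ 1 * y $ 1 + y $ 2 * y $ 2 + y $ 3 * y $ 3 + d * (y $ 0 * y $ 0))) x
      = (if \<nu> = 0 then x $ \<mu> else 0) + (if \<nu> = \<mu> then x $ 0 else 0)
        + 2 * c * (if \<nu> = 0 then d * x $ 0 else x $ \<nu>)" if "x \<in> U" for \<mu> \<nu> x c d
    using that exhaust_4[of \<nu>]
    by (auto simp: partial_add partial_mult partial_const partial_coord smooth_differentiable smooth)
  have partial: "partial \<nu> (\<lambda>y. K y $ \<mu>) x = (if \<nu> = 0 then x $ \<mu> else 0) + (if \<nu> = \<mu> then x $ 0 else 0)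
      + (if \<mu> = 0 then mink \<nu> \<nu> * x $ \<nu> else 0)" if "x \<in> U" for \<mu> \<nu> x
    unfolding comp quadratic[OF that] by (simp add: mink_def)
  have "vf_apply K rad x = x $ 0 * rad x" if "x \<in> U" for x
  proof -
    have "(\<Sum>\<mu>\<in>UNIV. if \<mu> = 0 then 0 else K x $ \<mu> * x $ \<mu>) = x $ 0 * (rad x)\<^sup>2"
      unfolding rad_square_sum sum_distrib_left by (intro sum.cong) (auto simp: K_def)
    then show ?thesis
      using pos[OF that] by (simp add: vf_apply_rad power2_eq_square)
  qed
  moreover have "partial \<mu> (partial \<mu> (\<lambda>y. y $ 0)) x = 0" for \<mu> x
    by (simp add: partial_coord[abs_def] partial_const[abs_def])
  moreover have "smooth_on U (\<lambda>y. K y $ \<mu>)" for \<mu>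
    unfolding comp by (intro smooth)
  ultimately show "conformal_on U K (\<lambda>x. x $ 0)"
    unfolding conformal_on_def by (auto simp: partial smooth_coord mink_def)
  fix y assume "y \<in> U"
  with pos have "rad y \<noteq> 0" by fastforce
  then show "K y = K_vf y"
    by (simp add: vec_eq_iff K_def K_vf_def L_vf_def Lbar_vf_def d_t_def d_r_def u_coord_def v_coord_def
        axis_def field_simps power2_eq_square)
qed

lemma conformal_Z_set:
  assumes "\<And>x. x \<in> U \<Longrightarrow> rad x > 0" "X \<in> Z_set"
  obtains \<phi> where "conformal_on U X \<phi>"
proof -
  have Omega: "conformal_on U (Omega_vf i j) (\<lambda>x. 0)" if "i \<noteq> 0" "j \<noteq> 0" for i j
    using conformal_Omega that assms(1) by blast
  from assms(2) consider "X = T_vf" | "X = Omega_vf 1 2" | "X = Omega_vf 2 3" | "X = Omega_vf 3 1"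
    | "X = S_vf" | "X = K_vf"
    unfolding Z_set_def by blast
  then show ?thesis
  proof cases
    case 1 then show ?thesis using that conformal_T assms(1) by blast
  next
    case 2 then show ?thesis using that Omega[of 1 2] by simp
  next
    case 3 then show ?thesis using that Omega[of 2 3] by simp
  next
    case 4 then show ?thesis using that Omega[of 3 1] by simp
  next
    case 5 then show ?thesis using that conformal_S assms(1) by blast
  next
    case 6 then show ?thesis using that conformal_K assms(1) by blast
  qed
qed

end

section \<open>The double commutator\<close>

lemma (in off_axis_potential) double_commutator:
  assumes X: "conformal_on U X \<phi>" and Y: "conformal_on U Y \<psi>" and f: "smooth_on U f" and x: "x \<in> U"
    and F: "F = ext_deriv A"
  shows "commutator (cov_hat A Y) (commutator (r2Box A) (cov_hat A X)) f x =
      of_real ((rad x)\<^sup>2) * Q A f F (lie_bracket Y X) x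
    + of_real ((rad x)\<^sup>2) * Q A f (lie_deriv Y F) X x
    + 2 * of_real ((rad x)\<^sup>2) * of_real (\<Sum>\<mu>\<in>UNIV. contr F Y x $ \<mu> * contr_up F X x $ \<mu>) * f x"
proof -
  note smX = conformal_onD(1)[OF X] and smY = conformal_onD(1)[OF Y]
  have smF: "smooth_on U (\<lambda>y. F y $ \<mu> $ \<nu>)" for \<mu> \<nu>
    unfolding F by (rule smooth_ext_deriv)
  define \<omega> where "\<omega> = contr_snd F X"
  have \<omega>: "smooth_on U (\<lambda>y. \<omega> y $ \<mu>)" for \<mu>
    unfolding \<omega>_def by (intro smooth_contr_snd smF smX)
  have Q: "smooth_on U (Q_form A f \<omega>)"
    unfolding Q_form_def[abs_def] div_form_eq by (intro smooth_intros smooth_cov f \<omega>)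
  have inner: "commutator (r2Box A) (cov_hat A X) g y = of_real ((rad y)\<^sup>2) * Q_form A g \<omega> y"
    if "smooth_on U g" "y \<in> U" for g y
    unfolding \<omega>_def F by (rule r2Box_commutator[OF X that])
  have "cov_hat A Y (commutator (r2Box A) (cov_hat A X) f) x
      = cov_hat A Y (\<lambda>y. of_real ((rad y)\<^sup>2) * Q_form A f \<omega> y) x"
    by (rule cov_hat_transfer[OF inner[OF f] x])
  also have "\<dots> = of_real (2 * \<psi> x * (rad x)\<^sup>2) * Q_form A f \<omega> x
      + of_real ((rad x)\<^sup>2) * cov_hat A Y (Q_form A f \<omega>) x"
    unfolding cov_hat_mult[OF smooth_rad_square Q x] vf_apply_radial[OF Y x rad_pos[OF x]] ..
  finally have "commutator (cov_hat A Y) (commutator (r2Box A) (cov_hat A X)) f x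
      = of_real ((rad x)\<^sup>2) * (cov_hat A Y (Q_form A f \<omega>) x + 2 * of_real (\<psi> x) * Q_form A f \<omega> x
          - Q_form A (cov_hat A Y f) \<omega> x)"
    using inner[OF smooth_cov_hat[OF Y f] x]
    by (simp add: commutator_def[of "cov_hat A Y"] algebra_simps)
  also have "\<dots> = of_real ((rad x)\<^sup>2) * (Q_form A f (lie_deriv_form Y \<omega>) x
      + 2 * of_real (\<Sum>\<mu>\<in>UNIV. mink \<mu> \<mu> * \<omega> x $ \<mu> * contr_snd F Y x $ \<mu>) * f x)"
    unfolding cov_hat_Q_form[OF Y \<omega> f x] F ..
  also have "Q_form A f (lie_deriv_form Y \<omega>) x
      = Q_form A f (contr_snd F (lie_bracket Y X)) x + Q_form A f (contr_snd (lie_deriv Y F) X) x"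
    unfolding \<omega>_def
    by (intro Q_form_add lie_deriv_form_contr_snd smooth_contr_snd smooth_lie_deriv smooth_lie_bracket
        smX smY smF x)
  also have "(\<Sum>\<mu>\<in>UNIV. mink \<mu> \<mu> * \<omega> x $ \<mu> * contr_snd F Y x $ \<mu>)
      = (\<Sum>\<mu>\<in>UNIV. contr F Y x $ \<mu> * contr_up F X x $ \<mu>)"
  proof (intro sum.cong refl)
    fix \<mu>
    \<comment> \<open>\<open>Q\<close> contracts a vector field into the second slot of \<open>F\<close> and the quadratic term into the first; the
      two changes of sign cancel.\<close>
    have skew: "F x $ \<mu> $ \<nu> = - F x $ \<nu> $ \<mu>" for \<mu> \<nu>
      by (simp add: F ext_deriv_def)
    have Z: "contr_snd F Z x $ \<mu> = - contr F Z x $ \<mu>" for Z \<mu>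
      unfolding contr_snd_def contr_def by (simp add: skew[of \<mu>] sum_negf)
    have "contr_up F X x $ \<mu> = (\<Sum>\<kappa>\<in>UNIV. mink \<mu> \<kappa> * contr F X x $ \<kappa>)"
      by (simp add: contr_up_def contr_def sum_distrib_left mult.assoc)
    then show "mink \<mu> \<mu> * \<omega> x $ \<mu> * contr_snd F Y x $ \<mu> = contr F Y x $ \<mu> * contr_up F X x $ \<mu>"
      by (simp add: \<omega>_def Z sum_mink_real)
  qed
  finally show ?thesis
    by (simp add: Q_eq_Q_form algebra_simps)
qed

theorem proposition2p5:
  fixes A :: one_form and F :: two_form and X Y :: vfield and f :: scalar_field and x :: point
  assumes "smooth_on UNIV A"
    and "F = ext_deriv A"
    and "X \<in> Z_set" and "Y \<in> Z_set"
    and "smooth_on {y. rad y > 0} f"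
    and "rad x > 0"
  shows "commutator (cov_hat A Y) (commutator (r2Box A) (cov_hat A X)) f x =
      of_real ((rad x)\<^sup>2) * Q A f F (lie_bracket Y X) x
    + of_real ((rad x)\<^sup>2) * Q A f (lie_deriv Y F) X x
    + 2 * of_real ((rad x)\<^sup>2) * of_real (\<Sum>\<mu>\<in>UNIV. contr F Y x $ \<mu> * contr_up F X x $ \<mu>) * f x"
proof -
  interpret everywhere: open_domain UNIV
    by unfold_locales simp
  have A: "smooth_on {y. rad y > 0} (\<lambda>y. A y $ \<mu>)" for \<mu>
    using everywhere.smooth_linear[OF bounded_linear_vec_nth assms(1)] smooth_on_subset by blast
  interpret off_axis_potential "{y. rad y > 0}" A
    using open_off_axis A by unfold_locales auto
  obtain \<phi> \<psi> where "conformal_on {y. rad y > 0} X \<phi>" "conformal_on {y. rad y > 0} Y \<psi>"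
    using conformal_Z_set assms(3,4) rad_pos by metis
  then show ?thesis
    using double_commutator assms(2,5,6) by blast
qed

end
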